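(* Let $0<t<T$ and let $B_t^T=P_t^T\,\mathbb{E}[Z_T\mid \mathcal{F}_t^{\zeta^T}]$. For a strike price $K$, the price at time $0$ of a $t$-maturity call option on $B_t^T$, namely $C_0^t=P_0^t\,\mathbb{E}[(B_t^T-K)^+]$, is given by $$C_{0}^{t}=P_0^t\sum_{i=1}^{l} (P_t^Tz_i-K)^+\Big(\int_{0}^{t}f(r,z_i)\,\mathrm{d}r\Big)p_i +P_0^t\int_{\mathbb{R}}\bigg(\sum_{i=1}^{l}(P_t^Tz_i-K)\Big[\int_{t}^{T}\varphi_{t}^{r,z_i}(x)f(r,z_i)\,\mathrm{d}r+F(T,z_i)\,\varphi_{t}^{T,z_i}(x)\Big]p_i\bigg)^+\mathrm{d}x.$$
   Context: Let $T>0$ and $\sigma>0$ be constants. On a complete probability space $(\Omega,\mathcal{F},\mathbb{P})$ let $W=(W_t)_{t\ge 0}$ be a standard Brownian motion, $\tau$ a strictly positive random time and $Z_T$ a real random variable, such that $W$ is independent of the pair $(\tau,Z_T)$ ($\tau$ and $Z_T$ need not be independent of each other). $Z_T$ takes values in a finite set $\{z_1,\dots,z_l\}$ of distinct reals, with $\mathbb{P}(Z_T=z_i)=p_i>0$, $\sum_i p_i=1$. Assume $\mathbb{P}(\tau\le T)<1$ and that for each $i$ the conditional law of $\tau$ given $Z_T=z_i$ has a continuous density $f(\cdot,z_i)$ with respect to Lebesgue measure on $\mathbb{R}_+$. Put $F(T,z_i)=\int_T^{+\infty}f(r,z_i)\,\mathrm{d}r$ and $\nu=\tau\wedge T$. The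 market information process is $$\zeta^T_t=W_{t\wedge \nu}-\frac{t\wedge \nu}{\nu}W_{\nu}+\sigma\frac{t\wedge \nu}{\nu}Z_T,\qquad t\in[0,T],$$ and $\mathbb{F}^{\zeta^T}=(\mathcal{F}^{\zeta^T}_t)_{0\le t\le T}$ is its natural filtration completed by the $\mathbb{P}$-null sets. The short rate $\rho$ is deterministic and $P_s^{t}=\exp\big(-\int_s^{t}\rho(u)\,\mathrm{d}u\big)$ for $0\le s\le t\le T$. We write $a^+=\max(a,0)$. $p(t,x,y)=\frac{1}{\sqrt{2\pi t}}e^{-(x-y)^2/(2t)}$ is the Gaussian density in $x$ with variance $t$ and mean $y$, and $\varphi_{t}^{r,z}(x)=p\big(\frac{t(r-t)}{r},x,\frac{t}{r}\sigma z\big)$ for $0<t<r$. *)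

theory Defs
  imports "HOL-Probability.Probability"
begin

text \<open>
  A standard Brownian motion indexed by \<open>t \<ge> 0\<close>; the values of \<open>W\<close> at negative times are
  irrelevant. The start at \<open>0\<close> and path continuity are required only almost surely.
\<close>

definition standard_brownian_motion :: "'a measure \<Rightarrow> (real \<Rightarrow> 'a \<Rightarrow> real) \<Rightarrow> bool" where
  "standard_brownian_motion M W \<longleftrightarrow>
     (\<forall>t\<ge>0. W t \<in> borel_measurable M) \<and>
     (AE \<omega> in M. W 0 \<omega> = 0) \<and>
     (AE \<omega> in M. continuous_on {0..} (\<lambda>t. W t \<omega>)) \<and>
     (\<forall>s t. 0 \<le> s \<and> s < t \<longrightarrow>
        distributed M lborel (\<lambda>\<omega>. W t \<omega> - W s \<omega>)
          (\<lambda>x. ennreal (normal_density 0 (sqrt (t - s)) x))) \<and>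
     (\<forall>(u :: nat \<Rightarrow> real) n. 0 \<le> u 0 \<and> (\<forall>k<n. u k < u (Suc k)) \<longrightarrow>
        prob_space.indep_vars M (\<lambda>_. borel) (\<lambda>k \<omega>. W (u (Suc k)) \<omega> - W (u k) \<omega>) {..<n})"

definition information_process ::
  "real \<Rightarrow> real \<Rightarrow> (real \<Rightarrow> 'a \<Rightarrow> real) \<Rightarrow> ('a \<Rightarrow> real) \<Rightarrow> ('a \<Rightarrow> real) \<Rightarrow> real \<Rightarrow> 'a \<Rightarrow> real" where
  "information_process T \<sigma> W \<tau> Z t \<omega> =
     (let \<nu> = min (\<tau> \<omega>) T
      in W (min t \<nu>) \<omega> - min t \<nu> / \<nu> * W \<nu> \<omega> + \<sigma> * (min t \<nu> / \<nu>) * Z \<omega>)"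

text \<open>
  The natural filtration of a process with time set starting at \<open>0\<close>, completed by all null sets
  of \<open>M\<close>. For complete \<open>M\<close>, \<open>null_sets M\<close> contains every subset of a null set.
\<close>

definition completed_natural_filtration ::
  "'a measure \<Rightarrow> (real \<Rightarrow> 'a \<Rightarrow> real) \<Rightarrow> real \<Rightarrow> 'a measure" where
  "completed_natural_filtration M X t =
     sigma (space M) ({X s -` A \<inter> space M | s A. s \<in> {0..t} \<and> A \<in> sets borel} \<union> null_sets M)"

definition discount :: "(real \<Rightarrow> real) \<Rightarrow> real \<Rightarrow> real \<Rightarrow> real" where
  "discount \<rho> s t = exp (- (LBINT u:{s..t}. \<rho> u))"

text \<open>
  The density at \<open>x\<close> of the Gaussian law with mean \<open>t/r \<cdot> \<sigma> z\<close> and variance \<open>t (r - t)/r\<close>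
  (\<^const>\<open>normal_density\<close> takes the standard deviation). It is meaningful for \<open>0 < t < r\<close>.
\<close>

definition bridge_density :: "real \<Rightarrow> real \<Rightarrow> real \<Rightarrow> real \<Rightarrow> real \<Rightarrow> real" where
  "bridge_density \<sigma> t r z x = normal_density (t / r * \<sigma> * z) (sqrt (t * (r - t) / r)) x"

definition density_tail :: "(real \<Rightarrow> real \<Rightarrow> real) \<Rightarrow> real \<Rightarrow> real \<Rightarrow> real" where
  "density_tail f T z = (LBINT r:{T..}. f r z)"

definition bond_price ::
  "'a measure \<Rightarrow> (real \<Rightarrow> real) \<Rightarrow> real \<Rightarrow> real \<Rightarrow> (real \<Rightarrow> 'a \<Rightarrow> real) \<Rightarrow> ('a \<Rightarrow> real) \<Rightarrow>
   ('a \<Rightarrow> real) \<Rightarrow> real \<Rightarrow> 'a \<Rightarrow> real" where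
  "bond_price M \<rho> T \<sigma> W \<tau> Z t \<omega> =
     discount \<rho> t T *
     real_cond_exp M (completed_natural_filtration M (information_process T \<sigma> W \<tau> Z) t) Z \<omega>"

definition call_price ::
  "'a measure \<Rightarrow> (real \<Rightarrow> real) \<Rightarrow> real \<Rightarrow> real \<Rightarrow> (real \<Rightarrow> 'a \<Rightarrow> real) \<Rightarrow> ('a \<Rightarrow> real) \<Rightarrow>
   ('a \<Rightarrow> real) \<Rightarrow> real \<Rightarrow> real \<Rightarrow> real" where
  "call_price M \<rho> T \<sigma> W \<tau> Z K t =
     discount \<rho> 0 t * (LINT \<omega>|M. max (bond_price M \<rho> T \<sigma> W \<tau> Z t \<omega> - K) 0)"

end

theory Submission
  imports Defs
begin

text \<open>
  If \<open>\<tau> \<le> t\<close> the bridge has already reached its pinning point, so \<open>\<zeta> t = \<sigma> Z\<close> reveals \<open>Z\<close>; conversely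
  \<open>\<zeta> t\<close> almost surely avoids the finitely many values of \<open>\<sigma> Z\<close> when \<open>\<tau> > t\<close>. On \<open>{\<tau> > t}\<close> one has
  \<open>\<zeta> s - (s/t) \<zeta> t = W s - (s/t) W t\<close> for \<open>s \<le> t\<close>, a Brownian bridge on \<open>[0, t]\<close> which is independent of
  \<open>(W u)\<close> for \<open>u \<ge> t\<close> and of \<open>(\<tau>, Z)\<close>, hence of \<open>(\<zeta> t, \<tau>, Z)\<close>. The observed past therefore carries no
  information beyond \<open>\<zeta> t\<close>, and the conditional law of \<open>Z\<close> is given by Bayes' formula with weights
  \<open>p\<^sub>i (\<integral>\<^sub>t\<^sup>T \<phi> f dr + F \<phi>)\<close>. In the price these weights cancel the normalising denominator.
\<close>

text \<open>The Brownian hypothesis speaks only of independent Gaussian increments, so independence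
  of bridge and endpoint is derived from explicit integral identities instead of covariances. Laws
  are handled through nonnegative integrals of test functions, which need no integrability. Two
  obstacles shape the rest. The path is evaluated at the random time
  \<open>min (\<tau> \<omega>) T\<close>, so independence must concern the whole path, and paths are
  continuous only almost surely. And a single Borel function of \<open>\<zeta> t\<close> must
  describe the conditional law both before and after \<open>\<tau>\<close>; the two cases are glued
  along a Lebesgue-null set of values. The tail \<open>F\<close> arises because every
  \<open>\<tau> > T\<close> leads to the same pinning time \<open>T\<close>.\<close>

subsection \<open>Gaussian bridges and independence\<close>

text \<open>The substitution from \<open>(y, d)\<close> to
  \<open>(y - u / v * (y + d), y + d)\<close> has determinant one and removes the cross term from
  the Gaussian exponent. Hence bridge value and endpoint are independent, with variances
  \<open>u * (v - u) / v\<close> and \<open>v\<close>.\<close>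

lemma nn_integral_gaussian_bridge:
  fixes h :: "real \<times> real \<Rightarrow> ennreal"
  assumes h: "h \<in> borel_measurable (borel \<Otimes>\<^sub>M borel)" and u: "0 < u" "u < v"
  shows "(\<integral>\<^sup>+y. (\<integral>\<^sup>+d. h (y - u / v * (y + d), y + d) * ennreal (normal_density 0 (sqrt (v - u)) d) \<partial>lborel)
            * ennreal (normal_density 0 (sqrt u) y) \<partial>lborel)
       = (\<integral>\<^sup>+x. (\<integral>\<^sup>+w. h (x, w) * ennreal (normal_density 0 (sqrt v) w) \<partial>lborel)
            * ennreal (normal_density 0 (sqrt (u * (v - u) / v)) x) \<partial>lborel)"
proof -
  note [measurable] = h
  have key: "normal_density 0 (sqrt (v - u)) (w - (x + u / v * w)) * normal_density 0 (sqrt u) (x + u / v * w)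
      = normal_density 0 (sqrt v) w * normal_density 0 (sqrt (u * (v - u) / v)) x" for x w
  proof -
    have nd: "normal_density 0 (sqrt a) y = exp (- y\<^sup>2 / (2 * a)) / sqrt (2 * pi * a)" if "0 < a" for a y
      using that by (simp add: normal_density_def)
    have e: "- (w - (x + u / v * w))\<^sup>2 / (2 * (v - u)) + - (x + u / v * w)\<^sup>2 / (2 * u)
        = - w\<^sup>2 / (2 * v) + - x\<^sup>2 / (2 * (u * (v - u) / v))"
    proof -
      define c where "c = u / v"
      have c: "u = c * v" "v - u = (1 - c) * v" "0 < c" "0 < 1 - c" "0 < v"
        using u by (auto simp: c_def field_simps)
      \<comment> \<open>With \<open>c = u / v\<close> every denominator is a multiple of
        \<open>v\<close>; once they are cleared, the equality of exponents is this identity, in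
        which the cross terms cancel.\<close>
      have p: "c * (w - (x + c * w))\<^sup>2 + (1 - c) * (x + c * w)\<^sup>2 = c * (1 - c) * w\<^sup>2 + x\<^sup>2"
        by (simp add: power2_eq_square algebra_simps)
      have "- (w - (x + u / v * w))\<^sup>2 / (2 * (v - u)) + - (x + u / v * w)\<^sup>2 / (2 * u)
          = - (w - (x + c * w))\<^sup>2 / (2 * ((1 - c) * v)) + - (x + c * w)\<^sup>2 / (2 * (c * v))"
        using c by (simp add: c_def)
      also have "\<dots> = - (c * (w - (x + c * w))\<^sup>2 + (1 - c) * (x + c * w)\<^sup>2) / (2 * (c * (1 - c) * v))"
        using c(3-5) by (simp add: divide_simps)
      also have "\<dots> = - w\<^sup>2 / (2 * v) + - x\<^sup>2 / (2 * (c * ((1 - c) * v)))"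
        unfolding p using c(3-5) by (simp add: divide_simps)
      also have "c * ((1 - c) * v) = u * (v - u) / v"
        using c by (simp add: c_def)
      finally show ?thesis .
    qed
    have s: "sqrt (2 * pi * (v - u)) * sqrt (2 * pi * u)
        = sqrt (2 * pi * v) * sqrt (2 * pi * (u * (v - u) / v))"
      unfolding real_sqrt_mult[symmetric] using u by (simp add: field_simps)
    have "u * (v - u) / v > 0" using u by simp
    then show ?thesis
      using u by (simp only: nd diff_gt_0_iff_gt times_divide_times_eq mult_exp_exp e s)
  qed
  \<comment> \<open>The planar substitution is done as two translations, \<open>w = y + d\<close>
    for fixed \<open>y\<close> and then \<open>x = y - u / v * w\<close> for fixed \<open>w\<close>,
    with Tonelli in between.\<close>
  have "(\<integral>\<^sup>+y. (\<integral>\<^sup>+d. h (y - u / v * (y + d), y + d) * ennreal (normal_density 0 (sqrt (v - u)) d) \<partial>lborel)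
            * ennreal (normal_density 0 (sqrt u) y) \<partial>lborel)
     = (\<integral>\<^sup>+y. (\<integral>\<^sup>+w. h (y - u / v * w, w) * ennreal (normal_density 0 (sqrt (v - u)) (w - y)) \<partial>lborel)
            * ennreal (normal_density 0 (sqrt u) y) \<partial>lborel)"
  proof (rule nn_integral_cong)
    fix y
    show "(\<integral>\<^sup>+d. h (y - u / v * (y + d), y + d) * ennreal (normal_density 0 (sqrt (v - u)) d) \<partial>lborel)
            * ennreal (normal_density 0 (sqrt u) y)
       = (\<integral>\<^sup>+w. h (y - u / v * w, w) * ennreal (normal_density 0 (sqrt (v - u)) (w - y)) \<partial>lborel)
            * ennreal (normal_density 0 (sqrt u) y)"
      by (subst (2) nn_integral_real_affine[where c=1 and t=y]) auto
  qed
  also have "\<dots> = (\<integral>\<^sup>+w. (\<integral>\<^sup>+y. h (y - u / v * w, w) * ennreal (normal_density 0 (sqrt (v - u)) (w - y))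
            * ennreal (normal_density 0 (sqrt u) y) \<partial>lborel) \<partial>lborel)"
    by (subst nn_integral_multc[symmetric]) (auto intro!: lborel_pair.Fubini')
  also have "\<dots> = (\<integral>\<^sup>+w. (\<integral>\<^sup>+x. h (x, w) * ennreal (normal_density 0 (sqrt (v - u)) (w - (x + u / v * w)))
            * ennreal (normal_density 0 (sqrt u) (x + u / v * w)) \<partial>lborel) \<partial>lborel)"
  proof (rule nn_integral_cong)
    fix w
    show "(\<integral>\<^sup>+y. h (y - u / v * w, w) * ennreal (normal_density 0 (sqrt (v - u)) (w - y))
            * ennreal (normal_density 0 (sqrt u) y) \<partial>lborel)
       = (\<integral>\<^sup>+x. h (x, w) * ennreal (normal_density 0 (sqrt (v - u)) (w - (x + u / v * w)))
            * ennreal (normal_density 0 (sqrt u) (x + u / v * w)) \<partial>lborel)"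
      by (subst nn_integral_real_affine[where c=1 and t="u / v * w"]) (auto simp: add.commute)
  qed
  also have "\<dots> = (\<integral>\<^sup>+w. (\<integral>\<^sup>+x. h (x, w) * ennreal (normal_density 0 (sqrt v) w)
            * ennreal (normal_density 0 (sqrt (u * (v - u) / v)) x) \<partial>lborel) \<partial>lborel)"
    by (simp add: mult.assoc ennreal_mult[symmetric] key[simplified])
  also have "\<dots> = (\<integral>\<^sup>+x. (\<integral>\<^sup>+w. h (x, w) * ennreal (normal_density 0 (sqrt v) w) \<partial>lborel)
            * ennreal (normal_density 0 (sqrt (u * (v - u) / v)) x) \<partial>lborel)"
    by (subst nn_integral_multc[symmetric]) (auto intro!: lborel_pair.Fubini')
  finally show ?thesis .
qed

text \<open>Rectangles determine the joint law as the product of the marginals, and Tonelli does the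
  rest. The hypothesis is the bare product rule on rectangles, so that both independent increments
  and the independence of the path from \<open>(\<tau>, Z)\<close> can be fed in.\<close>

lemma (in prob_space) nn_integral_independent:
  assumes X [measurable]: "X \<in> measurable M S" and Y [measurable]: "Y \<in> measurable M N"
    and indep: "\<And>A B. A \<in> sets S \<Longrightarrow> B \<in> sets N \<Longrightarrow>
      prob ((\<lambda>\<omega>. (X \<omega>, Y \<omega>)) -` (A \<times> B) \<inter> space M) = prob (X -` A \<inter> space M) * prob (Y -` B \<inter> space M)"
    and [measurable]: "\<Phi> \<in> borel_measurable (S \<Otimes>\<^sub>M N)"
  shows "(\<integral>\<^sup>+\<omega>. \<Phi> (X \<omega>, Y \<omega>) \<partial>M) = (\<integral>\<^sup>+\<omega>. \<integral>\<^sup>+\<omega>'. \<Phi> (X \<omega>, Y \<omega>') \<partial>M \<partial>M)"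
proof -
  interpret X: prob_space "distr M S X" by (rule prob_space_distr) simp
  interpret Y: prob_space "distr M N Y" by (rule prob_space_distr) simp
  have product: "distr M S X \<Otimes>\<^sub>M distr M N Y = distr M (S \<Otimes>\<^sub>M N) (\<lambda>\<omega>. (X \<omega>, Y \<omega>))"
  proof (rule pair_measure_eqI)
    fix A B assume "A \<in> sets (distr M S X)" "B \<in> sets (distr M N Y)"
    then have [measurable]: "A \<in> sets S" "B \<in> sets N" by auto
    show "emeasure (distr M S X) A * emeasure (distr M N Y) B
        = emeasure (distr M (S \<Otimes>\<^sub>M N) (\<lambda>\<omega>. (X \<omega>, Y \<omega>))) (A \<times> B)"
      using indep[of A B] by (simp add: emeasure_distr emeasure_eq_measure ennreal_mult'[symmetric])
  qed (auto intro: X.sigma_finite_measure Y.sigma_finite_measure)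
  have "(\<integral>\<^sup>+\<omega>. \<Phi> (X \<omega>, Y \<omega>) \<partial>M) = (\<integral>\<^sup>+x. \<Phi> x \<partial>distr M (S \<Otimes>\<^sub>M N) (\<lambda>\<omega>. (X \<omega>, Y \<omega>)))"
    by (simp add: nn_integral_distr)
  also have "\<dots> = (\<integral>\<^sup>+x. \<Phi> x \<partial>(distr M S X \<Otimes>\<^sub>M distr M N Y))"
    by (simp add: product)
  also have "\<dots> = (\<integral>\<^sup>+x. \<integral>\<^sup>+y. \<Phi> (x, y) \<partial>distr M N Y \<partial>distr M S X)"
    by (rule Y.nn_integral_fst[symmetric]) measurable
  also have "\<dots> = (\<integral>\<^sup>+\<omega>. \<integral>\<^sup>+y. \<Phi> (X \<omega>, y) \<partial>distr M N Y \<partial>M)"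
    by (rule nn_integral_distr) measurable
  also have "\<dots> = (\<integral>\<^sup>+\<omega>. \<integral>\<^sup>+\<omega>'. \<Phi> (X \<omega>, Y \<omega>') \<partial>M \<partial>M)"
  proof (rule nn_integral_cong)
    fix \<omega> assume "\<omega> \<in> space M"
    then have "X \<omega> \<in> space S" by (rule measurable_space[rotated]) simp
    then show "(\<integral>\<^sup>+y. \<Phi> (X \<omega>, y) \<partial>distr M N Y) = (\<integral>\<^sup>+\<omega>'. \<Phi> (X \<omega>, Y \<omega>') \<partial>M)"
      by (intro nn_integral_distr) measurable
  qed
  finally show ?thesis .
qed

section \<open>Measurability of a path evaluated at a random time\<close>

text \<open>Preimages under \<open>f\<close> and \<open>g\<close> differ by subsets of a null set,
  which completeness makes measurable.\<close>

lemma borel_measurable_complete_AE: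
  fixes f g :: "'a \<Rightarrow> 'b::topological_space"
  assumes "complete_measure M" and [measurable]: "g \<in> borel_measurable M" and "AE x in M. f x = g x"
  shows "f \<in> borel_measurable M"
proof -
  interpret complete_measure M by fact
  obtain N where N: "N \<in> null_sets M" "{x \<in> space M. f x \<noteq> g x} \<subseteq> N"
    using assms(3) by (auto simp: eventually_ae_filter)
  show ?thesis
  proof (rule measurableI)
    fix A :: "'b set" assume [measurable]: "A \<in> sets borel"
    have "f -` A \<inter> space M - (g -` A \<inter> space M) \<in> sets M" "g -` A \<inter> space M - (f -` A \<inter> space M) \<in> sets M"
      by (rule complete[OF _ N(1)], use N(2) in auto)+
    moreover have "f -` A \<inter> space M = (g -` A \<inter> space M - (g -` A \<inter> space M - (f -` A \<inter> space M)))
        \<union> (f -` A \<inter> space M - (g -` A \<inter> space M))"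
      by auto
    ultimately show "f -` A \<inter> space M \<in> sets M"
      by (metis (no_types, lifting) assms(2) \<open>A \<in> sets borel\<close> measurable_sets sets.Diff sets.Un)
  qed simp
qed

text \<open>
  The evaluation \<open>(w, u) \<mapsto> w u\<close> is not measurable for the product \<open>\<sigma>\<close>-algebra on paths; this limit is,
  and it agrees with \<open>w u\<close> on continuous paths.
\<close>

definition sampled_value :: "(real \<Rightarrow> real) \<Rightarrow> real \<Rightarrow> real" where
  "sampled_value w u = lim (\<lambda>n. w (real (nat \<lceil>real (Suc n) * u\<rceil>) / real (Suc n)))"

text \<open>For each \<open>n\<close> the sampling time takes countably many values, and at each of
  them evaluation is a coordinate projection; \<open>nat\<close> keeps the times inside the index
  set \<open>{0..}\<close>. Measurability survives the limit, including at pairs where the sequence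
  diverges.\<close>

lemma measurable_sampled_value:
  "(\<lambda>(w, u). sampled_value w u) \<in> borel_measurable (PiM {0..} (\<lambda>_. borel) \<Otimes>\<^sub>M borel)"
proof -
  have "(\<lambda>x. fst x (real (nat \<lceil>real (Suc n) * snd x\<rceil>) / real (Suc n)))
          \<in> borel_measurable (PiM {0::real..} (\<lambda>_. borel::real measure) \<Otimes>\<^sub>M (borel :: real measure))" for n
    by (rule measurable_compose_countable[where g="\<lambda>x. nat \<lceil>real (Suc n) * snd x\<rceil>"
          and f="\<lambda>k x. fst x (real k / real (Suc n))"]) measurable
  then show ?thesis
    unfolding sampled_value_def split_beta by (rule borel_measurable_lim_metric)
qed

text \<open>Rounding up puts the sampling time with index \<open>n\<close> between \<open>u\<close>
  and \<open>u + 1 / (n + 1)\<close>, so the path is approached from the right.\<close>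

lemma sampled_value_eq:
  assumes "continuous_on {0..} w" "0 \<le> u"
  shows "sampled_value w u = w u"
proof -
  let ?d = "\<lambda>n. real (nat \<lceil>real (Suc n) * u\<rceil>) / real (Suc n)"
  have c: "real (Suc n) * u \<le> real (nat \<lceil>real (Suc n) * u\<rceil>)"
    "real (nat \<lceil>real (Suc n) * u\<rceil>) \<le> real (Suc n) * u + 1" for n
    using assms(2) by (auto intro: real_nat_ceiling_ge of_nat_ceiling)
  have ge: "u \<le> ?d n" for n
    using c(1)[of n] by (simp add: pos_le_divide_eq mult.commute del: of_nat_Suc)
  have le: "?d n \<le> u + inverse (real (Suc n))" for n
  proof -
    have "?d n \<le> (real (Suc n) * u + 1) / real (Suc n)"
      by (rule divide_right_mono[OF c(2)]) simp
    also have "\<dots> = u + inverse (real (Suc n))" by (simp add: field_simps)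
    finally show ?thesis .
  qed
  have lim: "(\<lambda>n. u + inverse (real (Suc n))) \<longlonglongrightarrow> u"
    using tendsto_add[OF tendsto_const LIMSEQ_inverse_real_of_nat] by simp
  have "?d \<longlonglongrightarrow> u"
    by (rule tendsto_sandwich[OF _ _ tendsto_const lim]) (use ge le in auto)
  moreover have "\<forall>n. ?d n \<in> {0..}" by simp
  ultimately have "(\<lambda>n. w (?d n)) \<longlonglongrightarrow> w u"
    using assms continuous_on_sequentiallyI unfolding continuous_on_sequentially comp_def by auto
  then show ?thesis unfolding sampled_value_def by (rule limI)
qed

text \<open>The increment hypothesis is phrased for increasing sequences of times. Any finite set of
  times is embedded here in such a sequence from \<open>0\<close> to \<open>m\<close>; in the
  induction the largest time serves as endpoint for the others.\<close>

lemma finite_subset_partition: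
  fixes J :: "real set"
  assumes "finite J" "J \<subseteq> {0<..<m}" "0 < m"
  obtains u :: "nat \<Rightarrow> real" and n where "u 0 = 0" "u n = m" "\<And>k. k < n \<Longrightarrow> u k < u (Suc k)" "J \<subseteq> u ` {..n}"
proof -
  have "\<exists>u n. u (0::nat) = (0::real) \<and> u n = m \<and> (\<forall>k<n. u k < u (Suc k)) \<and> J \<subseteq> u ` {..n}"
    using assms
  proof (induction J arbitrary: m rule: finite_linorder_max_induct)
    case empty
    then show ?case by (intro exI[of _ "\<lambda>k. if k = 0 then 0 else m"] exI[of _ 1]) auto
  next
    case (insert b A)
    then have "A \<subseteq> {0<..<b}" "0 < b" by auto
    from insert.IH[OF this] obtain u n where u: "u (0::nat) = 0" "u n = b" "\<And>k. k < n \<Longrightarrow> u k < u (Suc k)" "A \<subseteq> u ` {..n}"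
      by blast
    have "(u(Suc n := m)) ` {..Suc n} = insert m (u ` {..n})"
      by (auto simp: atMost_Suc)
    then have "insert b A \<subseteq> (u(Suc n := m)) ` {..Suc n}"
      using u by auto
    then show ?case using u insert.prems
      by (intro exI[of _ "u(Suc n := m)"] exI[of _ "Suc n"]) (auto simp: less_Suc_eq)
  qed
  then show ?thesis using that by blast
qed

subsection \<open>Brownian bridge\<close>

lemma nn_integral_gaussian: "0 < \<sigma> \<Longrightarrow> (\<integral>\<^sup>+x. ennreal (normal_density \<mu> \<sigma> x) \<partial>lborel) = 1"
  by (subst nn_integral_eq_integral) auto

locale brownian_motion = prob_space M for M :: "'a measure" +
  fixes W :: "real \<Rightarrow> 'a \<Rightarrow> real"
  assumes brownian: "standard_brownian_motion M W"
begin

lemma measurable_W [measurable (raw)]: "0 \<le> t \<Longrightarrow> W t \<in> borel_measurable M"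
  and AE_W_0: "AE \<omega> in M. W 0 \<omega> = 0"
  and AE_continuous_W: "AE \<omega> in M. continuous_on {0..} (\<lambda>t. W t \<omega>)"
  and distributed_increment: "0 \<le> s \<Longrightarrow> s < t \<Longrightarrow> distributed M lborel (\<lambda>\<omega>. W t \<omega> - W s \<omega>)
          (\<lambda>x. ennreal (normal_density 0 (sqrt (t - s)) x))"
  and indep_increments: "0 \<le> u 0 \<Longrightarrow> (\<And>k. k < n \<Longrightarrow> u k < u (Suc k)) \<Longrightarrow>
        indep_vars (\<lambda>_. borel) (\<lambda>k \<omega>. W (u (Suc k)) \<omega> - W (u k) \<omega>) {..<n}"
  using brownian unfolding standard_brownian_motion_def by blast+

text \<open>Values of \<open>W\<close> at times up to \<open>m\<close> are partial sums of
  increments before \<open>m\<close>, and these are together independent of the increment from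
  \<open>m\<close> to \<open>r\<close>.\<close>

lemma nn_integral_past_increment:
  assumes J: "finite J" "J \<subseteq> {0<..m}" and m: "0 < m" "m < r"
    and [measurable]: "\<Phi> \<in> borel_measurable (PiM J (\<lambda>_. borel) \<Otimes>\<^sub>M borel)"
  shows "(\<integral>\<^sup>+\<omega>. \<Phi> (\<lambda>s\<in>J. W s \<omega>, W r \<omega> - W m \<omega>) \<partial>M)
       = (\<integral>\<^sup>+\<omega>. \<integral>\<^sup>+d. \<Phi> (\<lambda>s\<in>J. W s \<omega>, d) * ennreal (normal_density 0 (sqrt (r - m)) d) \<partial>lborel \<partial>M)"
proof -
  have "finite (J - {m})" "J - {m} \<subseteq> {0<..<m}" using J by auto
  from finite_subset_partition[OF this m(1)] obtain u n where u: "u 0 = 0" "u n = m"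
      "\<And>k. k < n \<Longrightarrow> u k < u (Suc k)" "J - {m} \<subseteq> u ` {..n}" by blast
  \<comment> \<open>Appending \<open>r\<close> makes the increment from \<open>m\<close> to
    \<open>r\<close> the one with index \<open>n\<close>, after all those of the past.\<close>
  define v where "v = u(Suc n := r)"
  have v: "v k < v (Suc k)" if "k < Suc n" for k
    using that u(3)[of k] u(2) m(2) by (cases "k = n") (auto simp: v_def)
  have "m \<in> u ` {..n}" using u(2) by blast
  with u(4) have "J \<subseteq> u ` {..n}" by blast
  then have "\<forall>s\<in>J. \<exists>k. k \<le> n \<and> u k = s" by blast
  then obtain idx where idx: "\<And>s. s \<in> J \<Longrightarrow> idx s \<le> n \<and> u (idx s) = s"
    by (auto dest!: bchoice)
  define D where "D = (\<lambda>k \<omega>. W (v (Suc k)) \<omega> - W (v k) \<omega>)"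
  have "indep_vars (\<lambda>_. borel) D {..<Suc n}"
    unfolding D_def by (rule indep_increments) (use v u(1) in \<open>auto simp: v_def\<close>)
  then have ind: "indep_var (PiM {..<n} (\<lambda>_. borel)) (\<lambda>\<omega>. restrict (\<lambda>i. D i \<omega>) {..<n})
      (PiM {n} (\<lambda>_. borel)) (\<lambda>\<omega>. restrict (\<lambda>i. D i \<omega>) {n})"
    by (rule indep_var_restrict) auto
  have Dn: "D n = (\<lambda>\<omega>. W r \<omega> - W m \<omega>)"
    using u(2) by (simp add: D_def v_def)
  \<comment> \<open>Telescoping rebuilds the values at \<open>J\<close> from the first
    \<open>n\<close> increments, but only almost surely, because \<open>W 0 = 0\<close> holds only
    almost surely.\<close>
  define L where "L = (\<lambda>x. \<lambda>s\<in>J. \<Sum>k<idx s. (x k :: real))"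
  have [measurable]: "L \<in> measurable (PiM {..<n} (\<lambda>_. borel)) (PiM J (\<lambda>_. borel))"
    unfolding L_def
  proof (intro measurable_restrict borel_measurable_sum measurable_component_singleton)
    fix s k assume "s \<in> J" "k \<in> {..<idx s}"
    then show "k \<in> {..<n}" using idx[of s] by simp
  qed
  have AE_L: "AE \<omega> in M. L (restrict (\<lambda>i. D i \<omega>) {..<n}) = (\<lambda>s\<in>J. W s \<omega>)"
    using AE_W_0
  proof eventually_elim
    fix \<omega> assume 0: "W 0 \<omega> = 0"
    have "(\<Sum>k<idx s. restrict (\<lambda>i. D i \<omega>) {..<n} k) = W s \<omega>" if "s \<in> J" for s
    proof -
      have "(\<Sum>k<idx s. restrict (\<lambda>i. D i \<omega>) {..<n} k) = (\<Sum>k<idx s. W (u (Suc k)) \<omega> - W (u k) \<omega>)"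
        using idx[OF that] by (intro sum.cong) (auto simp: D_def v_def)
      also have "\<dots> = W (u (idx s)) \<omega> - W (u 0) \<omega>"
        by (rule sum_lessThan_telescope)
      finally show ?thesis using idx[OF that] 0 u(1) by simp
    qed
    then show "L (restrict (\<lambda>i. D i \<omega>) {..<n}) = (\<lambda>s\<in>J. W s \<omega>)"
      unfolding L_def by (intro restrict_ext) auto
  qed
  have \<Phi>: "(\<lambda>(x, y). \<Phi> (L x, y n)) \<in> borel_measurable (PiM {..<n} (\<lambda>_. borel) \<Otimes>\<^sub>M PiM {n} (\<lambda>_. borel))"
    by measurable
  have "(\<integral>\<^sup>+\<omega>. \<Phi> (\<lambda>s\<in>J. W s \<omega>, W r \<omega> - W m \<omega>) \<partial>M)
      = (\<integral>\<^sup>+\<omega>. \<Phi> (L (restrict (\<lambda>i. D i \<omega>) {..<n}), D n \<omega>) \<partial>M)"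
    using AE_L by (intro nn_integral_cong_AE) (auto simp: Dn)
  also have "\<dots> = (\<integral>\<^sup>+\<omega>. \<integral>\<^sup>+\<omega>'. \<Phi> (L (restrict (\<lambda>i. D i \<omega>) {..<n}), D n \<omega>') \<partial>M \<partial>M)"
    by (rule nn_integral_independent[OF indep_var_rv1[OF ind] indep_var_rv2[OF ind] indep_varD[OF ind] \<Phi>,
          unfolded split_conv restrict_apply'[OF singletonI]])
  also have "\<dots> = (\<integral>\<^sup>+\<omega>. \<integral>\<^sup>+\<omega>'. \<Phi> (\<lambda>s\<in>J. W s \<omega>, D n \<omega>') \<partial>M \<partial>M)"
    using AE_L by (intro nn_integral_cong_AE) auto
  also have "\<dots> = (\<integral>\<^sup>+\<omega>. \<integral>\<^sup>+d. \<Phi> (\<lambda>s\<in>J. W s \<omega>, d) * ennreal (normal_density 0 (sqrt (r - m)) d) \<partial>lborel \<partial>M)"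
  proof (rule nn_integral_cong)
    fix \<omega>
    have "(\<lambda>s\<in>J. W s \<omega>) \<in> space (PiM J (\<lambda>_. borel))" by (simp add: space_PiM)
    then have "(\<lambda>d. \<Phi> (\<lambda>s\<in>J. W s \<omega>, d)) \<in> borel_measurable lborel"
      by measurable
    from distributed_nn_integral[OF distributed_increment[of m r] this]
    show "(\<integral>\<^sup>+\<omega>'. \<Phi> (\<lambda>s\<in>J. W s \<omega>, D n \<omega>') \<partial>M)
        = (\<integral>\<^sup>+d. \<Phi> (\<lambda>s\<in>J. W s \<omega>, d) * ennreal (normal_density 0 (sqrt (r - m)) d) \<partial>lborel)"
      using m by (simp add: Dn mult.commute)
  qed
  finally show ?thesis .
qed

definition bridge_vector :: "real set \<Rightarrow> real \<Rightarrow> 'a \<Rightarrow> real \<Rightarrow> real" where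
  "bridge_vector J t \<omega> = (\<lambda>s\<in>J. W s \<omega> - s / t * W t \<omega>)"

lemma measurable_bridge_vector [measurable]:
  assumes "J \<subseteq> {0<..<t}" "0 < t"
  shows "bridge_vector J t \<in> measurable M (PiM J (\<lambda>_. borel))"
  unfolding bridge_vector_def using assms by (intro measurable_restrict) (auto intro!: measurable_W borel_measurable_diff borel_measurable_times)

text \<open>Once the bridge on \<open>[0, m]\<close> is independent of \<open>W m\<close>, adding
  the independent increment up to \<open>t\<close> and applying the Gaussian exchange makes three
  things independent: that bridge, the value at \<open>m\<close> of the bridge on
  \<open>[0, t]\<close>, and \<open>W t\<close>. Independence at \<open>m\<close> is a hypothesis so
  that the step can serve inside an induction.\<close>

lemma nn_integral_bridge_step:
  assumes J: "finite J" "J \<subseteq> {0<..<m}" and m: "0 < m" "m < t"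
    and terminal: "\<And>\<Phi>. \<Phi> \<in> borel_measurable (PiM J (\<lambda>_. borel) \<Otimes>\<^sub>M borel) \<Longrightarrow>
       (\<integral>\<^sup>+\<omega>. \<Phi> (bridge_vector J m \<omega>, W m \<omega>) \<partial>M)
       = (\<integral>\<^sup>+\<omega>. \<integral>\<^sup>+y. \<Phi> (bridge_vector J m \<omega>, y) * ennreal (normal_density 0 (sqrt m) y) \<partial>lborel \<partial>M)"
    and G [measurable]: "G \<in> borel_measurable (PiM J (\<lambda>_. borel) \<Otimes>\<^sub>M (borel \<Otimes>\<^sub>M borel))"
  shows "(\<integral>\<^sup>+\<omega>. G (bridge_vector J m \<omega>, (W m \<omega> - m / t * W t \<omega>, W t \<omega>)) \<partial>M)
     = (\<integral>\<^sup>+\<omega>. \<integral>\<^sup>+x. (\<integral>\<^sup>+w. G (bridge_vector J m \<omega>, (x, w)) * ennreal (normal_density 0 (sqrt t) w) \<partial>lborel)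
          * ennreal (normal_density 0 (sqrt (m * (t - m) / t)) x) \<partial>lborel \<partial>M)"
proof -
  \<comment> \<open>The bridge on \<open>[0, m]\<close> is a function of \<open>W\<close> at the
    times \<open>insert m J\<close>, all at most \<open>m\<close>, so the next increment is
    independent of it.\<close>
  define B where "B = (\<lambda>x. \<lambda>s\<in>J. x s - s / m * (x m :: real))"
  have [measurable]: "B \<in> measurable (PiM (insert m J) (\<lambda>_. borel)) (PiM J (\<lambda>_. borel))"
    unfolding B_def by (intro measurable_restrict) measurable
  have B: "B (\<lambda>s\<in>insert m J. W s \<omega>) = bridge_vector J m \<omega>" for \<omega>
    unfolding B_def bridge_vector_def by (intro restrict_ext) auto
  define \<Psi> where "\<Psi> = (\<lambda>(x, d). G (B x, (x m - m / t * (x m + d), x m + d)))"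
  have [measurable]: "\<Psi> \<in> borel_measurable (PiM (insert m J) (\<lambda>_. borel) \<Otimes>\<^sub>M borel)"
    unfolding \<Psi>_def by measurable
  have "(\<integral>\<^sup>+\<omega>. G (bridge_vector J m \<omega>, (W m \<omega> - m / t * W t \<omega>, W t \<omega>)) \<partial>M)
      = (\<integral>\<^sup>+\<omega>. \<Psi> (\<lambda>s\<in>insert m J. W s \<omega>, W t \<omega> - W m \<omega>) \<partial>M)"
    by (simp add: \<Psi>_def B)
  also have "\<dots> = (\<integral>\<^sup>+\<omega>. \<integral>\<^sup>+d. \<Psi> (\<lambda>s\<in>insert m J. W s \<omega>, d) * ennreal (normal_density 0 (sqrt (t - m)) d) \<partial>lborel \<partial>M)"
    using J m by (intro nn_integral_past_increment) (auto simp: less_imp_le)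
  also have "\<dots> = (\<integral>\<^sup>+\<omega>. (\<lambda>(b, y). \<integral>\<^sup>+d. G (b, (y - m / t * (y + d), y + d)) *
      ennreal (normal_density 0 (sqrt (t - m)) d) \<partial>lborel) (bridge_vector J m \<omega>, W m \<omega>) \<partial>M)"
    by (simp add: \<Psi>_def B)
  also have "\<dots> = (\<integral>\<^sup>+\<omega>. \<integral>\<^sup>+y. (\<integral>\<^sup>+d. G (bridge_vector J m \<omega>, (y - m / t * (y + d), y + d)) *
      ennreal (normal_density 0 (sqrt (t - m)) d) \<partial>lborel) * ennreal (normal_density 0 (sqrt m) y) \<partial>lborel \<partial>M)"
    by (subst terminal) simp_all
  also have "\<dots> = (\<integral>\<^sup>+\<omega>. \<integral>\<^sup>+x. (\<integral>\<^sup>+w. G (bridge_vector J m \<omega>, (x, w)) * ennreal (normal_density 0 (sqrt t) w) \<partial>lborel)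
          * ennreal (normal_density 0 (sqrt (m * (t - m) / t)) x) \<partial>lborel \<partial>M)"
  proof (rule nn_integral_cong)
    fix \<omega>
    have "bridge_vector J m \<omega> \<in> space (PiM J (\<lambda>_. borel))" by (simp add: space_PiM bridge_vector_def)
    then have "(\<lambda>p. G (bridge_vector J m \<omega>, p)) \<in> borel_measurable (borel \<Otimes>\<^sub>M borel)" by measurable
    from nn_integral_gaussian_bridge[OF this m]
    show "(\<integral>\<^sup>+y. (\<integral>\<^sup>+d. G (bridge_vector J m \<omega>, (y - m / t * (y + d), y + d)) *
      ennreal (normal_density 0 (sqrt (t - m)) d) \<partial>lborel) * ennreal (normal_density 0 (sqrt m) y) \<partial>lborel)
      = (\<integral>\<^sup>+x. (\<integral>\<^sup>+w. G (bridge_vector J m \<omega>, (x, w)) * ennreal (normal_density 0 (sqrt t) w) \<partial>lborel)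
          * ennreal (normal_density 0 (sqrt (m * (t - m) / t)) x) \<partial>lborel)" .
  qed
  finally show ?thesis .
qed

text \<open>Induction on the largest time \<open>m\<close>. The bridge on \<open>[0, t]\<close> at
  times up to \<open>m\<close> is determined by the bridge on \<open>[0, m]\<close> and its own
  value at \<open>m\<close>, and the step lemma makes both independent of
  \<open>W t\<close>.\<close>

lemma nn_integral_bridge_terminal:
  assumes "finite J" "J \<subseteq> {0<..<t}" "0 < t"
    and "\<Phi> \<in> borel_measurable (PiM J (\<lambda>_. borel) \<Otimes>\<^sub>M borel)"
  shows "(\<integral>\<^sup>+\<omega>. \<Phi> (bridge_vector J t \<omega>, W t \<omega>) \<partial>M)
       = (\<integral>\<^sup>+\<omega>. \<integral>\<^sup>+y. \<Phi> (bridge_vector J t \<omega>, y) * ennreal (normal_density 0 (sqrt t) y) \<partial>lborel \<partial>M)"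
  using assms
proof (induction J arbitrary: t \<Phi> rule: finite_linorder_max_induct)
  case empty
  note [measurable] = empty.prems(3)
  \<comment> \<open>The unique point of the product space over no times: restriction to the empty
    set gives \<open>undefined\<close> everywhere.\<close>
  define e :: "real \<Rightarrow> real" where "e = (\<lambda>_. undefined)"
  have e: "bridge_vector {} t = (\<lambda>_. e)" by (simp add: fun_eq_iff bridge_vector_def e_def)
  have "e \<in> space (PiM {} (\<lambda>_. borel))" by (simp add: space_PiM e_def)
  then have [measurable]: "(\<lambda>y. \<Phi> (e, y)) \<in> borel_measurable borel" by measurable
  have "(\<integral>\<^sup>+\<omega>. \<Phi> (e, W t \<omega>) \<partial>M) = (\<integral>\<^sup>+\<omega>. \<Phi> (e, W t \<omega> - W 0 \<omega>) \<partial>M)"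
    using AE_W_0 by (intro nn_integral_cong_AE) auto
  also have "\<dots> = (\<integral>\<^sup>+y. \<Phi> (e, y) * ennreal (normal_density 0 (sqrt t) y) \<partial>lborel)"
    using distributed_nn_integral[OF distributed_increment[of 0 t], of "\<lambda>y. \<Phi> (e, y)"] empty.prems
    by (simp add: mult.commute)
  finally show ?case unfolding e by (simp add: emeasure_space_1)
next
  case (insert m J)
  note [measurable] = insert.prems(3)
  have m: "J \<subseteq> {0<..<m}" "0 < m" "m < t" using insert by auto
  \<comment> \<open>For \<open>s < m\<close> this is \<open>W s - s/t * W t = (W s - s/m * W m) +
    s/m * (W m - m/t * W t)\<close>.\<close>
  define ext where "ext = (\<lambda>(b, x). \<lambda>s\<in>insert m J. if s = m then x else b s + s / m * (x :: real))"
  have [measurable]: "ext \<in> measurable (PiM J (\<lambda>_. borel) \<Otimes>\<^sub>M borel) (PiM (insert m J) (\<lambda>_. borel))"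
    unfolding ext_def split_beta
  proof (rule measurable_restrict)
    fix s assume "s \<in> insert m J"
    then show "(\<lambda>x. if s = m then snd x else fst x s + s / m * snd x) \<in> borel_measurable (PiM J (\<lambda>_. borel) \<Otimes>\<^sub>M borel)"
      by (cases "s = m") auto
  qed
  have ext: "bridge_vector (insert m J) t \<omega> = ext (bridge_vector J m \<omega>, W m \<omega> - m / t * W t \<omega>)" for \<omega>
    unfolding bridge_vector_def ext_def split
    using m by (intro restrict_ext) (auto simp: field_simps)
  define \<Psi> where "\<Psi> c = (\<integral>\<^sup>+w. \<Phi> (c, w) * ennreal (normal_density 0 (sqrt t) w) \<partial>lborel)" for c
  have [measurable]: "\<Psi> \<in> borel_measurable (PiM (insert m J) (\<lambda>_. borel))"
    unfolding \<Psi>_def by measurable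
  note step = nn_integral_bridge_step[OF insert.hyps(1) m insert.IH[OF m(1,2)]]
  have "(\<integral>\<^sup>+\<omega>. \<Phi> (bridge_vector (insert m J) t \<omega>, W t \<omega>) \<partial>M)
     = (\<integral>\<^sup>+\<omega>. (\<lambda>(b, (x, w)). \<Phi> (ext (b, x), w)) (bridge_vector J m \<omega>, (W m \<omega> - m / t * W t \<omega>, W t \<omega>)) \<partial>M)"
    by (simp add: ext)
  also have "\<dots> = (\<integral>\<^sup>+\<omega>. \<integral>\<^sup>+x. \<Psi> (ext (bridge_vector J m \<omega>, x))
          * ennreal (normal_density 0 (sqrt (m * (t - m) / t)) x) \<partial>lborel \<partial>M)"
    by (subst step) (simp_all add: \<Psi>_def)
  \<comment> \<open>A Gaussian factor of mass one in \<open>w\<close> is inserted so that the step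
    lemma can be read backwards, with a test function that ignores the endpoint.\<close>
  also have "\<dots> = (\<integral>\<^sup>+\<omega>. \<integral>\<^sup>+x. (\<integral>\<^sup>+w. \<Psi> (ext (bridge_vector J m \<omega>, x)) * ennreal (normal_density 0 (sqrt t) w) \<partial>lborel)
          * ennreal (normal_density 0 (sqrt (m * (t - m) / t)) x) \<partial>lborel \<partial>M)"
    using m by (simp add: nn_integral_cmult nn_integral_gaussian)
  also have "\<dots> = (\<integral>\<^sup>+\<omega>. (\<lambda>(b, (x, w)). \<Psi> (ext (b, x))) (bridge_vector J m \<omega>, (W m \<omega> - m / t * W t \<omega>, W t \<omega>)) \<partial>M)"
    by (subst step) simp_all
  also have "\<dots> = (\<integral>\<^sup>+\<omega>. \<Psi> (bridge_vector (insert m J) t \<omega>) \<partial>M)"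
    by (simp add: ext)
  finally show ?case by (simp add: \<Psi>_def)
qed

text \<open>The bridge step at \<open>m = t\<close> with horizon \<open>r\<close>, the endpoint
  \<open>W r\<close> integrated out. It gives the noise part of \<open>\<zeta> t\<close> once the
  pinning time \<open>r\<close> is frozen.\<close>

lemma nn_integral_bridge:
  assumes J: "finite J" "J \<subseteq> {0<..<t}" and t: "0 < t" "t < r"
    and [measurable]: "\<Phi> \<in> borel_measurable (PiM J (\<lambda>_. borel) \<Otimes>\<^sub>M borel)"
  shows "(\<integral>\<^sup>+\<omega>. \<Phi> (bridge_vector J t \<omega>, W t \<omega> - t / r * W r \<omega>) \<partial>M)
       = (\<integral>\<^sup>+\<omega>. \<integral>\<^sup>+x. \<Phi> (bridge_vector J t \<omega>, x)
            * ennreal (normal_density 0 (sqrt (t * (r - t) / r)) x) \<partial>lborel \<partial>M)"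
proof -
  have "(\<integral>\<^sup>+\<omega>. (\<lambda>(b, (x, w)). \<Phi> (b, x)) (bridge_vector J t \<omega>, (W t \<omega> - t / r * W r \<omega>, W r \<omega>)) \<partial>M)
     = (\<integral>\<^sup>+\<omega>. \<integral>\<^sup>+x. (\<integral>\<^sup>+w. \<Phi> (bridge_vector J t \<omega>, x) * ennreal (normal_density 0 (sqrt r) w) \<partial>lborel)
          * ennreal (normal_density 0 (sqrt (t * (r - t) / r)) x) \<partial>lborel \<partial>M)"
    by (subst nn_integral_bridge_step[OF J t nn_integral_bridge_terminal[OF J t(1)]]) simp_all
  then show ?thesis using t by (simp add: nn_integral_cmult nn_integral_gaussian)
qed

end

subsection \<open>The information process\<close>

lemma borel_measurable_bridge_density:
  assumes [measurable]: "r \<in> borel_measurable N" "x \<in> borel_measurable N" "a \<in> borel_measurable N"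
  shows "(\<lambda>\<omega>. bridge_density \<sigma> t (r \<omega>) (a \<omega>) (x \<omega>)) \<in> borel_measurable N"
  unfolding bridge_density_def normal_density_def by measurable

lemma bridge_density_nonneg [simp]: "0 \<le> bridge_density \<sigma> t r a x"
  by (simp add: bridge_density_def)

locale bridge_market = brownian_motion M W for M :: "'a measure" and W +
  fixes \<tau> Z :: "'a \<Rightarrow> real" and T \<sigma> t :: real
  assumes complete: "complete_measure M"
    and \<sigma>_pos: "0 < \<sigma>"
    and measurable_\<tau> [measurable]: "\<tau> \<in> borel_measurable M"
    and \<tau>_pos: "\<And>\<omega>. \<omega> \<in> space M \<Longrightarrow> 0 < \<tau> \<omega>"
    and measurable_Z [measurable]: "Z \<in> borel_measurable M"
    and indep: "indep_set
           (sets (vimage_algebra (space M) (\<lambda>\<omega>. \<lambda>s\<in>{0..}. W s \<omega>) (PiM {0..} (\<lambda>_. borel))))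
           (sets (vimage_algebra (space M) (\<lambda>\<omega>. (\<tau> \<omega>, Z \<omega>)) (borel \<Otimes>\<^sub>M borel)))"
    and t_pos: "0 < t" and t_less: "t < T"
begin

abbreviation \<zeta> where "\<zeta> \<equiv> information_process T \<sigma> W \<tau> Z"

definition path :: "'a \<Rightarrow> real \<Rightarrow> real" where "path \<omega> = (\<lambda>s\<in>{0..}. W s \<omega>)"

lemma path_apply: "0 \<le> s \<Longrightarrow> path \<omega> s = W s \<omega>"
  by (simp add: path_def)

lemma measurable_path [measurable]: "path \<in> measurable M (PiM {0..} (\<lambda>_. borel))"
  unfolding path_def by (intro measurable_restrict measurable_W) auto

text \<open>Freezes \<open>(\<tau>, Z)\<close> and integrates over an independent copy of the path.
  The test function sees the whole path because it will be evaluated at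
  \<open>min (\<tau> \<omega>) T\<close>, which varies with \<open>\<omega>\<close>.\<close>

lemma nn_integral_path:
  assumes "\<Phi> \<in> borel_measurable ((borel \<Otimes>\<^sub>M borel) \<Otimes>\<^sub>M PiM {0..} (\<lambda>_. borel))"
  shows "(\<integral>\<^sup>+\<omega>. \<Phi> ((\<tau> \<omega>, Z \<omega>), path \<omega>) \<partial>M) = (\<integral>\<^sup>+\<omega>. \<integral>\<^sup>+\<omega>'. \<Phi> ((\<tau> \<omega>, Z \<omega>), path \<omega>') \<partial>M \<partial>M)"
proof (rule nn_integral_independent[OF _ _ _ assms])
  fix A B
  assume A: "A \<in> sets (borel \<Otimes>\<^sub>M borel :: (real \<times> real) measure)"
    and B: "B \<in> sets (PiM {0::real..} (\<lambda>_. borel :: real measure))"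
  have "path -` B \<inter> space M \<in> sets (vimage_algebra (space M) (\<lambda>\<omega>. \<lambda>s\<in>{0..}. W s \<omega>) (PiM {0..} (\<lambda>_. borel)))"
    using in_vimage_algebra[OF B, of "\<lambda>\<omega>. \<lambda>s\<in>{0..}. W s \<omega>" "space M"] by (simp add: path_def[abs_def])
  moreover have "(\<lambda>\<omega>. (\<tau> \<omega>, Z \<omega>)) -` A \<inter> space M
      \<in> sets (vimage_algebra (space M) (\<lambda>\<omega>. (\<tau> \<omega>, Z \<omega>)) (borel \<Otimes>\<^sub>M borel))"
    by (rule in_vimage_algebra[OF A])
  ultimately have "prob ((path -` B \<inter> space M) \<inter> ((\<lambda>\<omega>. (\<tau> \<omega>, Z \<omega>)) -` A \<inter> space M))
      = prob (path -` B \<inter> space M) * prob ((\<lambda>\<omega>. (\<tau> \<omega>, Z \<omega>)) -` A \<inter> space M)"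
    by (rule indep_setD[OF indep])
  moreover have "(\<lambda>\<omega>. ((\<tau> \<omega>, Z \<omega>), path \<omega>)) -` (A \<times> B) \<inter> space M
      = (path -` B \<inter> space M) \<inter> ((\<lambda>\<omega>. (\<tau> \<omega>, Z \<omega>)) -` A \<inter> space M)"
    by auto
  ultimately show "prob ((\<lambda>\<omega>. ((\<tau> \<omega>, Z \<omega>), path \<omega>)) -` (A \<times> B) \<inter> space M)
      = prob ((\<lambda>\<omega>. (\<tau> \<omega>, Z \<omega>)) -` A \<inter> space M) * prob (path -` B \<inter> space M)"
    by (simp only: mult.commute)
qed simp_all

lemma AE_sampled_path: "AE \<omega> in M. \<forall>u\<ge>0. sampled_value (path \<omega>) u = W u \<omega>"
  using AE_continuous_W
proof eventually_elim
  fix \<omega> assume c: "continuous_on {0..} (\<lambda>t. W t \<omega>)"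
  show "\<forall>u\<ge>0. sampled_value (path \<omega>) u = W u \<omega>"
  proof (intro allI impI)
    fix u :: real assume "0 \<le> u"
    have "sampled_value (path \<omega>) u = sampled_value (\<lambda>t. W t \<omega>) u"
      unfolding sampled_value_def by (simp add: path_apply)
    then show "sampled_value (path \<omega>) u = W u \<omega>"
      using sampled_value_eq[OF c \<open>0 \<le> u\<close>] by simp
  qed
qed

text \<open>Evaluation of \<open>W\<close> at the random time \<open>min (\<tau> \<omega>) T\<close>
  is not covered by the measurability of each \<open>W t\<close>. With the sampled path in place of
  \<open>W\<close> the expression is measurable, it is almost surely unchanged by path continuity,
  and completeness transfers measurability back.\<close>

lemma borel_measurable_\<zeta> [measurable]:
  assumes "0 \<le> s"
  shows "\<zeta> s \<in> borel_measurable M"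
proof (rule borel_measurable_complete_AE[OF complete])
  have V [measurable]: "(\<lambda>\<omega>. sampled_value (path \<omega>) (u \<omega>)) \<in> borel_measurable M"
    if [measurable]: "u \<in> borel_measurable M" for u
    using measurable_compose[OF measurable_Pair[OF measurable_path that] measurable_sampled_value] by simp
  show "(\<lambda>\<omega>. let \<nu> = min (\<tau> \<omega>) T
      in sampled_value (path \<omega>) (min s \<nu>) - min s \<nu> / \<nu> * sampled_value (path \<omega>) \<nu> + \<sigma> * (min s \<nu> / \<nu>) * Z \<omega>)
      \<in> borel_measurable M"
    unfolding Let_def by measurable
  show "AE \<omega> in M. \<zeta> s \<omega> = (let \<nu> = min (\<tau> \<omega>) T
      in sampled_value (path \<omega>) (min s \<nu>) - min s \<nu> / \<nu> * sampled_value (path \<omega>) \<nu> + \<sigma> * (min s \<nu> / \<nu>) * Z \<omega>)"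
    using AE_sampled_path AE_space
  proof eventually_elim
    case (elim \<omega>)
    then show ?case
      using \<tau>_pos[of \<omega>] t_pos t_less assms by (simp add: information_process_def Let_def)
  qed
qed

lemma \<zeta>_early: "\<omega> \<in> space M \<Longrightarrow> \<tau> \<omega> \<le> t \<Longrightarrow> \<zeta> t \<omega> = \<sigma> * Z \<omega>"
  using \<tau>_pos[of \<omega>] t_less by (simp add: information_process_def)

lemma \<zeta>_late:
  assumes "t < \<tau> \<omega>" "s \<le> t"
  shows "\<zeta> s \<omega> = W s \<omega> - s / min (\<tau> \<omega>) T * W (min (\<tau> \<omega>) T) \<omega> + \<sigma> * (s / min (\<tau> \<omega>) T) * Z \<omega>"
  using assms t_less by (simp add: information_process_def Let_def min_absorb1)

text \<open>Subtracting the chord to \<open>(t, \<zeta> t)\<close> removes every trace of \<open>\<tau>\<close> and \<open>Z\<close>.\<close>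

lemma \<zeta>_bridge:
  assumes "t < \<tau> \<omega>" "s \<le> t"
  shows "\<zeta> s \<omega> = (W s \<omega> - s / t * W t \<omega>) + s / t * \<zeta> t \<omega>"
proof -
  have "min (\<tau> \<omega>) T \<noteq> 0" using assms t_pos t_less by auto
  then show ?thesis
    unfolding \<zeta>_late[OF assms] \<zeta>_late[OF assms(1) order_refl] using t_pos by (simp add: field_simps)
qed

section \<open>The signal on the event that \<open>\<tau>\<close> exceeds \<open>t\<close>\<close>

text \<open>This turns out to be the Lebesgue density of \<open>\<zeta> t\<close> on the event
  \<open>t < \<tau>\<close>, \<open>Z = a\<close>, so its mass is the probability of that event.
  Extended values are kept because finiteness is only obtained almost everywhere.\<close>

definition late_density :: "real \<Rightarrow> real \<Rightarrow> ennreal" where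
  "late_density a x = (\<integral>\<^sup>+\<omega>. ennreal (bridge_density \<sigma> t (min (\<tau> \<omega>) T) a x)
      * indicator {\<omega> \<in> space M. t < \<tau> \<omega> \<and> Z \<omega> = a} \<omega> \<partial>M)"

lemma borel_measurable_late_density [measurable]: "late_density a \<in> borel_measurable borel"
proof -
  note borel_measurable_bridge_density [measurable (raw)]
  show ?thesis unfolding late_density_def[abs_def] by measurable
qed

text \<open>For a frozen pinning time \<open>r > t\<close> and \<open>Z = a\<close>,
  \<open>\<zeta> t\<close> is \<open>W t - t / r * W r\<close> plus a constant and is independent of
  the bridge on \<open>[0, t]\<close>, whose law involves neither \<open>r\<close> nor
  \<open>a\<close>. Averaging over \<open>(\<tau>, Z)\<close> therefore changes only the density in
  \<open>x\<close>.\<close>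

lemma nn_integral_late:
  assumes J: "finite J" "J \<subseteq> {0<..<t}"
    and [measurable]: "\<Phi> \<in> borel_measurable (PiM J (\<lambda>_. borel) \<Otimes>\<^sub>M borel)"
  shows "(\<integral>\<^sup>+\<omega>. \<Phi> (bridge_vector J t \<omega>, \<zeta> t \<omega>) * indicator {\<omega> \<in> space M. t < \<tau> \<omega> \<and> Z \<omega> = a} \<omega> \<partial>M)
       = (\<integral>\<^sup>+\<omega>. \<integral>\<^sup>+x. \<Phi> (bridge_vector J t \<omega>, x) * late_density a x \<partial>lborel \<partial>M)"
proof -
  note borel_measurable_bridge_density [measurable (raw)]
  note measurable_bridge_vector [OF J(2) t_pos, measurable]
  let ?I = "\<lambda>\<omega>. indicator {\<omega> \<in> space M. t < \<tau> \<omega> \<and> Z \<omega> = a} \<omega> :: ennreal"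
  define B where "B = (\<lambda>w. \<lambda>s\<in>J. w s - s / t * (w t :: real))"
  have [measurable]: "B \<in> measurable (PiM {0..} (\<lambda>_. borel)) (PiM J (\<lambda>_. borel))"
    unfolding B_def using J t_pos
    by (intro measurable_restrict borel_measurable_diff borel_measurable_times borel_measurable_const measurable_component_singleton) auto
  have B: "B (path \<omega>) = bridge_vector J t \<omega>" for \<omega>
    unfolding B_def bridge_vector_def using J t_pos by (intro restrict_ext) (auto simp: path_apply subset_iff)
  define \<Theta> where "\<Theta> = (\<lambda>((r, a'), w). \<Phi> (B w, w t - t / min r T * sampled_value w (min r T)
      + \<sigma> * (t / min r T) * a') * indicator ({t<..} \<times> {a}) (r, a'))"
  have [measurable]: "(\<lambda>x. fst (fst x)) \<in> borel_measurable ((borel \<Otimes>\<^sub>M borel) \<Otimes>\<^sub>M PiM {0..} (\<lambda>_. borel))"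
    "(\<lambda>x. snd x t) \<in> borel_measurable ((borel \<Otimes>\<^sub>M borel :: (real \<times> real) measure) \<Otimes>\<^sub>M PiM {0..} (\<lambda>_. borel :: real measure))"
    using t_pos by (auto intro!: measurable_compose[OF measurable_snd measurable_component_singleton])
  have [measurable]: "(\<lambda>x. sampled_value (snd x) (min (fst (fst x)) T))
      \<in> borel_measurable ((borel \<Otimes>\<^sub>M borel :: (real \<times> real) measure) \<Otimes>\<^sub>M PiM {0..} (\<lambda>_. borel))"
  proof -
    have "(\<lambda>x. (snd x, min (fst (fst x)) T)) \<in> measurable ((borel \<Otimes>\<^sub>M borel :: (real \<times> real) measure) \<Otimes>\<^sub>M PiM {0..} (\<lambda>_. borel))
        (PiM {0::real..} (\<lambda>_. borel :: real measure) \<Otimes>\<^sub>M borel)" by measurable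
    from measurable_compose[OF this measurable_sampled_value] show ?thesis by simp
  qed
  have [measurable]: "\<Theta> \<in> borel_measurable ((borel \<Otimes>\<^sub>M borel) \<Otimes>\<^sub>M PiM {0..} (\<lambda>_. borel))"
    unfolding \<Theta>_def split_beta by measurable
  have inner: "(\<integral>\<^sup>+\<omega>'. \<Theta> ((\<tau> \<omega>, Z \<omega>), path \<omega>') \<partial>M)
      = (\<integral>\<^sup>+\<omega>'. \<integral>\<^sup>+x. \<Phi> (bridge_vector J t \<omega>', x) *
          (ennreal (bridge_density \<sigma> t (min (\<tau> \<omega>) T) a x) * ?I \<omega>) \<partial>lborel \<partial>M)" if \<omega>: "\<omega> \<in> space M" for \<omega>
  proof (cases "t < \<tau> \<omega> \<and> Z \<omega> = a")
    case False
    then show ?thesis by (auto simp: \<Theta>_def)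
  next
    case True
    \<comment> \<open>Here \<open>t < T\<close> keeps the pinning time strictly beyond
      \<open>t\<close>, so the bridge variance \<open>t * (r - t) / r\<close> is positive.\<close>
    define r where "r = min (\<tau> \<omega>) T"
    have r: "t < r" using True t_less by (simp add: r_def)
    define \<mu> where "\<mu> = t / r * \<sigma> * a"
    have "(\<integral>\<^sup>+\<omega>'. \<Theta> ((\<tau> \<omega>, Z \<omega>), path \<omega>') \<partial>M)
        = (\<integral>\<^sup>+\<omega>'. (\<lambda>(b, x). \<Phi> (b, x + \<mu>)) (bridge_vector J t \<omega>', W t \<omega>' - t / r * W r \<omega>') \<partial>M)"
      using AE_sampled_path
    proof (intro nn_integral_cong_AE, eventually_elim)
      fix \<omega>' assume "\<forall>u\<ge>0. sampled_value (path \<omega>') u = W u \<omega>'"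
      then show "\<Theta> ((\<tau> \<omega>, Z \<omega>), path \<omega>')
          = (case (bridge_vector J t \<omega>', W t \<omega>' - t / r * W r \<omega>') of (b, x) \<Rightarrow> \<Phi> (b, x + \<mu>))"
        using True t_pos r by (simp add: \<Theta>_def B path_apply r_def[symmetric] \<mu>_def mult_ac)
    qed
    also have "\<dots> = (\<integral>\<^sup>+\<omega>'. \<integral>\<^sup>+x. \<Phi> (bridge_vector J t \<omega>', x + \<mu>)
            * ennreal (normal_density 0 (sqrt (t * (r - t) / r)) x) \<partial>lborel \<partial>M)"
      by (subst nn_integral_bridge[OF J t_pos r]) simp_all
    also have "\<dots> = (\<integral>\<^sup>+\<omega>'. \<integral>\<^sup>+x. \<Phi> (bridge_vector J t \<omega>', x) * ennreal (bridge_density \<sigma> t r a x) \<partial>lborel \<partial>M)"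
    proof (rule nn_integral_cong)
      fix \<omega>' assume \<omega>': "\<omega>' \<in> space M"
      have "bridge_vector J t \<omega>' \<in> space (PiM J (\<lambda>_. borel))" by (simp add: space_PiM bridge_vector_def)
      then have [measurable]: "(\<lambda>x. \<Phi> (bridge_vector J t \<omega>', x)) \<in> borel_measurable borel" by measurable
      show "(\<integral>\<^sup>+x. \<Phi> (bridge_vector J t \<omega>', x + \<mu>) * ennreal (normal_density 0 (sqrt (t * (r - t) / r)) x) \<partial>lborel)
          = (\<integral>\<^sup>+x. \<Phi> (bridge_vector J t \<omega>', x) * ennreal (bridge_density \<sigma> t r a x) \<partial>lborel)"
        by (subst (2) nn_integral_real_affine[where c=1 and t="\<mu>"])
          (auto simp: bridge_density_def normal_density_def \<mu>_def add.commute)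
    qed
    finally show ?thesis using True \<omega> by (simp add: r_def)
  qed
  interpret product_self: pair_sigma_finite M M ..
  interpret product_lborel: pair_sigma_finite M lborel ..
  have "(\<integral>\<^sup>+\<omega>. \<Phi> (bridge_vector J t \<omega>, \<zeta> t \<omega>) * ?I \<omega> \<partial>M) = (\<integral>\<^sup>+\<omega>. \<Theta> ((\<tau> \<omega>, Z \<omega>), path \<omega>) \<partial>M)"
    using AE_sampled_path AE_space
  proof (intro nn_integral_cong_AE, eventually_elim)
    fix \<omega> assume \<omega>: "\<forall>u\<ge>0. sampled_value (path \<omega>) u = W u \<omega>" "\<omega> \<in> space M"
    show "\<Phi> (bridge_vector J t \<omega>, \<zeta> t \<omega>) * ?I \<omega> = \<Theta> ((\<tau> \<omega>, Z \<omega>), path \<omega>)"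
    proof (cases "t < \<tau> \<omega> \<and> Z \<omega> = a")
      case True
      then show ?thesis
        using \<omega> \<zeta>_late[of \<omega> t] t_pos t_less by (simp add: \<Theta>_def B path_apply)
    qed (auto simp: \<Theta>_def)
  qed
  also have "\<dots> = (\<integral>\<^sup>+\<omega>. \<integral>\<^sup>+\<omega>'. \<Theta> ((\<tau> \<omega>, Z \<omega>), path \<omega>') \<partial>M \<partial>M)"
    by (rule nn_integral_path) measurable
  also have "\<dots> = (\<integral>\<^sup>+\<omega>. \<integral>\<^sup>+\<omega>'. \<integral>\<^sup>+x. \<Phi> (bridge_vector J t \<omega>', x) *
          (ennreal (bridge_density \<sigma> t (min (\<tau> \<omega>) T) a x) * ?I \<omega>) \<partial>lborel \<partial>M \<partial>M)"
    by (intro nn_integral_cong inner)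
  \<comment> \<open>\<open>\<omega>'\<close> carries the path and \<open>\<omega>\<close> the pair
    \<open>(\<tau>, Z)\<close>. Moving the integral over \<open>\<omega>\<close> innermost lets it
    act on the bridge density alone.\<close>
  also have "\<dots> = (\<integral>\<^sup>+\<omega>'. \<integral>\<^sup>+\<omega>. \<integral>\<^sup>+x. \<Phi> (bridge_vector J t \<omega>', x) *
          (ennreal (bridge_density \<sigma> t (min (\<tau> \<omega>) T) a x) * ?I \<omega>) \<partial>lborel \<partial>M \<partial>M)"
    by (rule product_self.Fubini') measurable
  also have "\<dots> = (\<integral>\<^sup>+\<omega>'. \<integral>\<^sup>+x. \<integral>\<^sup>+\<omega>. \<Phi> (bridge_vector J t \<omega>', x) *
          (ennreal (bridge_density \<sigma> t (min (\<tau> \<omega>) T) a x) * ?I \<omega>) \<partial>M \<partial>lborel \<partial>M)"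
  proof (rule nn_integral_cong)
    fix \<omega>'
    have "bridge_vector J t \<omega>' \<in> space (PiM J (\<lambda>_. borel))" by (simp add: space_PiM bridge_vector_def)
    then have [measurable]: "(\<lambda>x. \<Phi> (bridge_vector J t \<omega>', x)) \<in> borel_measurable borel" by measurable
    show "(\<integral>\<^sup>+\<omega>. \<integral>\<^sup>+x. \<Phi> (bridge_vector J t \<omega>', x) *
          (ennreal (bridge_density \<sigma> t (min (\<tau> \<omega>) T) a x) * ?I \<omega>) \<partial>lborel \<partial>M)
      = (\<integral>\<^sup>+x. \<integral>\<^sup>+\<omega>. \<Phi> (bridge_vector J t \<omega>', x) *
          (ennreal (bridge_density \<sigma> t (min (\<tau> \<omega>) T) a x) * ?I \<omega>) \<partial>M \<partial>lborel)"
      by (rule product_lborel.Fubini'[symmetric]) measurable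
  qed
  also have "\<dots> = (\<integral>\<^sup>+\<omega>'. \<integral>\<^sup>+x. \<Phi> (bridge_vector J t \<omega>', x) * late_density a x \<partial>lborel \<partial>M)"
    unfolding late_density_def by (intro nn_integral_cong nn_integral_cmult) measurable
  finally show ?thesis .
qed

end

subsection \<open>Filtering the terminal signal\<close>

locale finite_bridge_market = bridge_market M W \<tau> Z T \<sigma> t
  for M :: "'a measure" and W \<tau> Z and T \<sigma> t :: real +
  fixes V :: "real set"
  assumes finite_V: "finite V"
    and Z_in_V: "\<And>\<omega>. \<omega> \<in> space M \<Longrightarrow> Z \<omega> \<in> V"
begin

lemma nn_integral_late_density:
  "(\<integral>\<^sup>+x. late_density a x \<partial>lborel) = emeasure M {\<omega> \<in> space M. t < \<tau> \<omega> \<and> Z \<omega> = a}"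
  using nn_integral_late[of "{}" "\<lambda>_. 1" a] by (simp add: emeasure_space_1)

text \<open>\<open>enn2real\<close> turns an infinite density into \<open>0\<close>, which affects
  only a Lebesgue-null set; real weights allow the quotient in Bayes' formula.\<close>

definition late_weight :: "real \<Rightarrow> real \<Rightarrow> real" where
  "late_weight a x = enn2real (late_density a x)"

lemma late_weight_nonneg [simp]: "0 \<le> late_weight a x"
  by (simp add: late_weight_def)

lemma borel_measurable_late_weight [measurable]: "late_weight a \<in> borel_measurable borel"
  unfolding late_weight_def[abs_def] by measurable

lemma AE_late_density: "AE x in lborel. late_density a x = ennreal (late_weight a x)"
proof -
  have "AE x in lborel. late_density a x \<noteq> \<infinity>"
    by (rule nn_integral_PInf_AE) (simp_all add: nn_integral_late_density)
  then show ?thesis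
    by eventually_elim (simp add: late_weight_def less_top)
qed

lemma AE_late_density_V: "AE x in lborel. \<forall>a\<in>V. late_density a x = ennreal (late_weight a x)"
  by (intro AE_finite_allI finite_V AE_late_density)

lemma AE_lborel_not_signal: "AE x in lborel. x \<notin> (\<lambda>a. \<sigma> * a) ` V"
  by (rule AE_not_in) (simp add: finite_V finite_imp_null_set_lborel)

text \<open>
  On \<open>\<sigma> V\<close>, which is Lebesgue-null, the value is chosen to be correct on \<open>{\<tau> \<le> t}\<close>, where
  \<open>\<zeta> t = \<sigma> Z\<close>; off \<open>\<sigma> V\<close> it is Bayes' formula on \<open>{t < \<tau>}\<close>.
\<close>

definition posterior :: "real \<Rightarrow> real \<Rightarrow> real" where
  "posterior a x = (if x \<in> (\<lambda>a. \<sigma> * a) ` V then indicator {\<sigma> * a} x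
      else late_weight a x / (\<Sum>b\<in>V. late_weight b x))"

lemma borel_measurable_posterior [measurable]: "posterior a \<in> borel_measurable borel"
proof -
  have [measurable]: "(\<lambda>a. \<sigma> * a) ` V \<in> sets borel"
    using finite_V by (intro borel_closed finite_imp_closed) simp
  show ?thesis unfolding posterior_def[abs_def] by measurable
qed

lemma posterior_nonneg [simp]: "0 \<le> posterior a x"
  by (simp add: posterior_def sum_nonneg)

lemma posterior_le_1: "a \<in> V \<Longrightarrow> posterior a x \<le> 1"
  using member_le_sum[of a V "\<lambda>b. late_weight b x"] finite_V
    sum_nonneg[of V "\<lambda>b. late_weight b x"]
  by (auto simp: posterior_def divide_le_eq_1 split: split_indicator)

lemma posterior_signal: "\<omega> \<in> space M \<Longrightarrow> posterior a (\<sigma> * Z \<omega>) = indicator {\<omega>. Z \<omega> = a} \<omega>"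
  using Z_in_V \<sigma>_pos by (auto simp: posterior_def split: split_indicator)

text \<open>Also true where all weights vanish: the quotient is then \<open>0\<close> by the
  convention on division, and the weight of \<open>a\<close> is a term of a vanishing sum of
  nonnegative terms.\<close>

lemma posterior_times_sum:
  assumes "a \<in> V" "x \<notin> (\<lambda>a. \<sigma> * a) ` V"
  shows "posterior a x * (\<Sum>b\<in>V. late_weight b x) = late_weight a x"
proof (cases "(\<Sum>b\<in>V. late_weight b x) = 0")
  case True
  then have "late_weight a x = 0"
    using assms finite_V by (simp add: sum_nonneg_eq_0_iff)
  then show ?thesis using True by simp
next
  case False
  then show ?thesis using assms by (simp add: posterior_def)
qed

lemma indicator_late:
  "\<omega> \<in> space M \<Longrightarrow> (indicator {\<omega> \<in> space M. t < \<tau> \<omega>} \<omega> :: ennreal)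
     = (\<Sum>a\<in>V. indicator {\<omega> \<in> space M. t < \<tau> \<omega> \<and> Z \<omega> = a} \<omega>)"
  using Z_in_V[of \<omega>] finite_V by (simp add: indicator_def)

text \<open>Splitting by the finitely many values of \<open>Z\<close> shows that the sum of the
  weights is the density of \<open>\<zeta> t\<close> on \<open>t < \<tau>\<close>, the denominator
  in Bayes' formula.\<close>

lemma nn_integral_late_sum:
  assumes J: "finite J" "J \<subseteq> {0<..<t}"
    and [measurable]: "\<Phi> \<in> borel_measurable (PiM J (\<lambda>_. borel) \<Otimes>\<^sub>M borel)"
  shows "(\<integral>\<^sup>+\<omega>. \<Phi> (bridge_vector J t \<omega>, \<zeta> t \<omega>) * indicator {\<omega> \<in> space M. t < \<tau> \<omega>} \<omega> \<partial>M)
     = (\<integral>\<^sup>+\<omega>. \<integral>\<^sup>+x. \<Phi> (bridge_vector J t \<omega>, x) * ennreal (\<Sum>a\<in>V. late_weight a x) \<partial>lborel \<partial>M)"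
proof -
  note measurable_bridge_vector [OF J(2) t_pos, measurable]
  note borel_measurable_\<zeta>[OF less_imp_le[OF t_pos], measurable]
  have "(\<integral>\<^sup>+\<omega>. \<Phi> (bridge_vector J t \<omega>, \<zeta> t \<omega>) * indicator {\<omega> \<in> space M. t < \<tau> \<omega>} \<omega> \<partial>M)
      = (\<integral>\<^sup>+\<omega>. (\<Sum>a\<in>V. \<Phi> (bridge_vector J t \<omega>, \<zeta> t \<omega>) * indicator {\<omega> \<in> space M. t < \<tau> \<omega> \<and> Z \<omega> = a} \<omega>) \<partial>M)"
    by (intro nn_integral_cong) (simp add: indicator_late sum_distrib_left)
  also have "\<dots> = (\<Sum>a\<in>V. \<integral>\<^sup>+\<omega>. \<integral>\<^sup>+x. \<Phi> (bridge_vector J t \<omega>, x) * late_density a x \<partial>lborel \<partial>M)"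
    by (subst nn_integral_sum) (simp_all add: nn_integral_late[OF J])
  also have "\<dots> = (\<integral>\<^sup>+\<omega>. (\<Sum>a\<in>V. \<integral>\<^sup>+x. \<Phi> (bridge_vector J t \<omega>, x) * late_density a x \<partial>lborel) \<partial>M)"
    by (rule nn_integral_sum[symmetric]) measurable
  also have "\<dots> = (\<integral>\<^sup>+\<omega>. \<integral>\<^sup>+x. \<Phi> (bridge_vector J t \<omega>, x) * ennreal (\<Sum>a\<in>V. late_weight a x) \<partial>lborel \<partial>M)"
  proof (rule nn_integral_cong)
    fix \<omega>
    have "bridge_vector J t \<omega> \<in> space (PiM J (\<lambda>_. borel))" by (simp add: space_PiM bridge_vector_def)
    then have [measurable]: "(\<lambda>x. \<Phi> (bridge_vector J t \<omega>, x)) \<in> borel_measurable borel" by measurable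
    have "(\<Sum>a\<in>V. \<integral>\<^sup>+x. \<Phi> (bridge_vector J t \<omega>, x) * late_density a x \<partial>lborel)
        = (\<integral>\<^sup>+x. (\<Sum>a\<in>V. \<Phi> (bridge_vector J t \<omega>, x) * late_density a x) \<partial>lborel)"
      by (rule nn_integral_sum[symmetric]) measurable
    also have "\<dots> = (\<integral>\<^sup>+x. \<Phi> (bridge_vector J t \<omega>, x) * ennreal (\<Sum>a\<in>V. late_weight a x) \<partial>lborel)"
      using AE_late_density_V
      by (intro nn_integral_cong_AE, eventually_elim) (simp add: sum_distrib_left[symmetric] sum_ennreal)
    finally show "(\<Sum>a\<in>V. \<integral>\<^sup>+x. \<Phi> (bridge_vector J t \<omega>, x) * late_density a x \<partial>lborel)
        = (\<integral>\<^sup>+x. \<Phi> (bridge_vector J t \<omega>, x) * ennreal (\<Sum>a\<in>V. late_weight a x) \<partial>lborel)" .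
  qed
  finally show ?thesis .
qed

text \<open>Bayes' formula, tested against functions of the bridge and \<open>\<zeta> t\<close>.
  Almost everywhere the posterior times the total weight is the weight of \<open>a\<close>, so both
  sides reduce to the same integral.\<close>

lemma nn_integral_late_posterior:
  assumes a: "a \<in> V" and J: "finite J" "J \<subseteq> {0<..<t}"
    and [measurable]: "\<Phi> \<in> borel_measurable (PiM J (\<lambda>_. borel) \<Otimes>\<^sub>M borel)"
  shows "(\<integral>\<^sup>+\<omega>. \<Phi> (bridge_vector J t \<omega>, \<zeta> t \<omega>) * indicator {\<omega> \<in> space M. t < \<tau> \<omega> \<and> Z \<omega> = a} \<omega> \<partial>M)
     = (\<integral>\<^sup>+\<omega>. \<Phi> (bridge_vector J t \<omega>, \<zeta> t \<omega>) * ennreal (posterior a (\<zeta> t \<omega>))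
          * indicator {\<omega> \<in> space M. t < \<tau> \<omega>} \<omega> \<partial>M)"
proof -
  have "(\<integral>\<^sup>+\<omega>. (\<lambda>(b, x). \<Phi> (b, x) * ennreal (posterior a x)) (bridge_vector J t \<omega>, \<zeta> t \<omega>)
          * indicator {\<omega> \<in> space M. t < \<tau> \<omega>} \<omega> \<partial>M)
      = (\<integral>\<^sup>+\<omega>. \<integral>\<^sup>+x. \<Phi> (bridge_vector J t \<omega>, x) * ennreal (posterior a x)
          * ennreal (\<Sum>a\<in>V. late_weight a x) \<partial>lborel \<partial>M)"
    by (subst nn_integral_late_sum[OF J]) simp_all
  also have "\<dots> = (\<integral>\<^sup>+\<omega>. \<integral>\<^sup>+x. \<Phi> (bridge_vector J t \<omega>, x) * late_density a x \<partial>lborel \<partial>M)"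
  proof (rule nn_integral_cong)
    fix \<omega>
    show "(\<integral>\<^sup>+x. \<Phi> (bridge_vector J t \<omega>, x) * ennreal (posterior a x) * ennreal (\<Sum>a\<in>V. late_weight a x) \<partial>lborel)
        = (\<integral>\<^sup>+x. \<Phi> (bridge_vector J t \<omega>, x) * late_density a x \<partial>lborel)"
      using AE_late_density[of a] AE_lborel_not_signal
      by (intro nn_integral_cong_AE, eventually_elim)
        (simp add: mult.assoc ennreal_mult[symmetric] sum_nonneg posterior_times_sum[OF a])
  qed
  also have "\<dots> = (\<integral>\<^sup>+\<omega>. \<Phi> (bridge_vector J t \<omega>, \<zeta> t \<omega>) * indicator {\<omega> \<in> space M. t < \<tau> \<omega> \<and> Z \<omega> = a} \<omega> \<partial>M)"
    by (rule nn_integral_late[OF J, symmetric]) measurable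
  finally show ?thesis by simp
qed

text \<open>The event is split by whether \<open>\<tau> \<le> t\<close>. If so, the two integrands
  agree pointwise, since the posterior at \<open>\<sigma> * Z \<omega>\<close> is an indicator;
  otherwise the event is a condition on the bridge and \<open>\<zeta> t\<close>, and Bayes' formula
  applies. \<open>E\<close> is prescribed only almost surely, to accommodate the completed
  filtration.\<close>

lemma nn_integral_posterior_cylinder:
  assumes a: "a \<in> V" and J: "finite J" "J \<subseteq> {0<..<t}"
    and A: "\<And>s. A s \<in> sets borel" and C [measurable]: "C \<in> sets borel"
    and E [measurable]: "E \<in> sets M"
    and AE_E: "AE \<omega> in M. \<omega> \<in> E \<longleftrightarrow> \<zeta> t \<omega> \<in> C \<and> (\<forall>s\<in>J. \<zeta> s \<omega> \<in> A s)"
  shows "(\<integral>\<^sup>+\<omega>. indicator {\<omega> \<in> space M. Z \<omega> = a} \<omega> * indicator E \<omega> \<partial>M)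
      = (\<integral>\<^sup>+\<omega>. ennreal (posterior a (\<zeta> t \<omega>)) * indicator E \<omega> \<partial>M)"
proof -
  note measurable_bridge_vector [OF J(2) t_pos, measurable]
  note borel_measurable_\<zeta>[OF less_imp_le[OF t_pos], measurable]
  \<comment> \<open>The conditions on the earlier values \<open>\<zeta> s\<close>, rewritten by
    adding the chord \<open>s / t * \<zeta> t\<close> back to the bridge.\<close>
  define Q where "Q = {p \<in> space (PiM J (\<lambda>_. borel) \<Otimes>\<^sub>M borel). snd p \<in> C \<and> (\<forall>s\<in>J. fst p s + s / t * snd p \<in> A s)}"
  have [measurable]: "Q \<in> sets (PiM J (\<lambda>_. borel) \<Otimes>\<^sub>M borel)"
  proof -
    have "Measurable.pred (PiM J (\<lambda>_. borel) \<Otimes>\<^sub>M borel) (\<lambda>p. fst p s + s / t * snd p \<in> A s)" if "s \<in> J" for s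
    proof -
      note A[of s, measurable]
      have [measurable]: "(\<lambda>p. fst p s) \<in> borel_measurable (PiM J (\<lambda>_. borel) \<Otimes>\<^sub>M (borel :: real measure))"
        using that by (rule measurable_compose[OF measurable_fst measurable_component_singleton])
      show ?thesis by measurable
    qed
    then have "{p \<in> space (PiM J (\<lambda>_. borel) \<Otimes>\<^sub>M borel). \<forall>s\<in>J. fst p s + s / t * snd p \<in> A s}
        \<in> sets (PiM J (\<lambda>_. borel) \<Otimes>\<^sub>M borel)"
      using J(1) by (intro sets.sets_Collect_finite_All) (simp_all add: pred_def)
    moreover have "{p \<in> space (PiM J (\<lambda>_. borel :: real measure) \<Otimes>\<^sub>M borel). snd p \<in> C}
        \<in> sets (PiM J (\<lambda>_. borel) \<Otimes>\<^sub>M borel)" by measurable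
    ultimately show ?thesis unfolding Q_def by (rule sets.sets_Collect_conj)
  qed
  \<comment> \<open>The free factor \<open>y\<close> lets one rewriting serve both sides:
    \<open>1\<close> on the side of the indicator of \<open>Z = a\<close>, the posterior value on
    the other.\<close>
  have late: "indicator E \<omega> * indicator {\<omega> \<in> space M. t < \<tau> \<omega>} \<omega> * y
      = indicator Q (bridge_vector J t \<omega>, \<zeta> t \<omega>) * indicator {\<omega> \<in> space M. t < \<tau> \<omega>} \<omega> * (y :: ennreal)"
    if "\<omega> \<in> E \<longleftrightarrow> \<zeta> t \<omega> \<in> C \<and> (\<forall>s\<in>J. \<zeta> s \<omega> \<in> A s)" for \<omega> y
  proof (cases "t < \<tau> \<omega>")
    case True
    have "bridge_vector J t \<omega> s + s / t * \<zeta> t \<omega> = \<zeta> s \<omega>" if "s \<in> J" for s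
      using \<zeta>_bridge[OF True, of s] that J(2) by (auto simp: bridge_vector_def)
    then have "\<omega> \<in> E \<longleftrightarrow> (bridge_vector J t \<omega>, \<zeta> t \<omega>) \<in> Q"
      using that by (simp add: Q_def space_pair_measure space_PiM bridge_vector_def)
    then show ?thesis by (simp add: indicator_def)
  qed simp
  have "(\<integral>\<^sup>+\<omega>. indicator {\<omega> \<in> space M. Z \<omega> = a} \<omega> * indicator E \<omega> \<partial>M)
     = (\<integral>\<^sup>+\<omega>. indicator {\<omega> \<in> space M. Z \<omega> = a} \<omega> * indicator E \<omega> * indicator {\<omega> \<in> space M. \<tau> \<omega> \<le> t} \<omega>
         + indicator Q (bridge_vector J t \<omega>, \<zeta> t \<omega>) * indicator {\<omega> \<in> space M. t < \<tau> \<omega> \<and> Z \<omega> = a} \<omega> \<partial>M)"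
    using AE_E AE_space
  proof (intro nn_integral_cong_AE, eventually_elim)
    fix \<omega> assume *: "\<omega> \<in> E \<longleftrightarrow> \<zeta> t \<omega> \<in> C \<and> (\<forall>s\<in>J. \<zeta> s \<omega> \<in> A s)" "\<omega> \<in> space M"
    show "indicator {\<omega> \<in> space M. Z \<omega> = a} \<omega> * indicator E \<omega>
      = indicator {\<omega> \<in> space M. Z \<omega> = a} \<omega> * indicator E \<omega> * indicator {\<omega> \<in> space M. \<tau> \<omega> \<le> t} \<omega>
         + indicator Q (bridge_vector J t \<omega>, \<zeta> t \<omega>) * (indicator {\<omega> \<in> space M. t < \<tau> \<omega> \<and> Z \<omega> = a} \<omega> :: ennreal)"
      using late[OF *(1), of 1] *(2) by (cases "t < \<tau> \<omega>") (auto simp: indicator_def)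
  qed
  also have "\<dots> = (\<integral>\<^sup>+\<omega>. indicator {\<omega> \<in> space M. Z \<omega> = a} \<omega> * indicator E \<omega> * indicator {\<omega> \<in> space M. \<tau> \<omega> \<le> t} \<omega> \<partial>M)
         + (\<integral>\<^sup>+\<omega>. indicator Q (bridge_vector J t \<omega>, \<zeta> t \<omega>) * indicator {\<omega> \<in> space M. t < \<tau> \<omega> \<and> Z \<omega> = a} \<omega> \<partial>M)"
    by (intro nn_integral_add) measurable
  also have "(\<integral>\<^sup>+\<omega>. indicator Q (bridge_vector J t \<omega>, \<zeta> t \<omega>) * indicator {\<omega> \<in> space M. t < \<tau> \<omega> \<and> Z \<omega> = a} \<omega> \<partial>M)
     = (\<integral>\<^sup>+\<omega>. indicator Q (bridge_vector J t \<omega>, \<zeta> t \<omega>) * ennreal (posterior a (\<zeta> t \<omega>))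
          * indicator {\<omega> \<in> space M. t < \<tau> \<omega>} \<omega> \<partial>M)"
    by (rule nn_integral_late_posterior[OF a J]) measurable
  also have "(\<integral>\<^sup>+\<omega>. indicator {\<omega> \<in> space M. Z \<omega> = a} \<omega> * indicator E \<omega> * indicator {\<omega> \<in> space M. \<tau> \<omega> \<le> t} \<omega> \<partial>M)
      + (\<integral>\<^sup>+\<omega>. indicator Q (bridge_vector J t \<omega>, \<zeta> t \<omega>) * ennreal (posterior a (\<zeta> t \<omega>))
          * indicator {\<omega> \<in> space M. t < \<tau> \<omega>} \<omega> \<partial>M)
      = (\<integral>\<^sup>+\<omega>. indicator {\<omega> \<in> space M. Z \<omega> = a} \<omega> * indicator E \<omega> * indicator {\<omega> \<in> space M. \<tau> \<omega> \<le> t} \<omega>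
      + indicator Q (bridge_vector J t \<omega>, \<zeta> t \<omega>) * ennreal (posterior a (\<zeta> t \<omega>))
          * indicator {\<omega> \<in> space M. t < \<tau> \<omega>} \<omega> \<partial>M)"
    by (intro nn_integral_add[symmetric]) measurable
  also have "\<dots> = (\<integral>\<^sup>+\<omega>. ennreal (posterior a (\<zeta> t \<omega>)) * indicator E \<omega> \<partial>M)"
    using AE_E AE_space
  proof (intro nn_integral_cong_AE, eventually_elim)
    fix \<omega> assume *: "\<omega> \<in> E \<longleftrightarrow> \<zeta> t \<omega> \<in> C \<and> (\<forall>s\<in>J. \<zeta> s \<omega> \<in> A s)" "\<omega> \<in> space M"
    show "indicator {\<omega> \<in> space M. Z \<omega> = a} \<omega> * indicator E \<omega> * indicator {\<omega> \<in> space M. \<tau> \<omega> \<le> t} \<omega>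
      + indicator Q (bridge_vector J t \<omega>, \<zeta> t \<omega>) * ennreal (posterior a (\<zeta> t \<omega>))
          * indicator {\<omega> \<in> space M. t < \<tau> \<omega>} \<omega>
      = ennreal (posterior a (\<zeta> t \<omega>)) * indicator E \<omega>"
    proof (cases "t < \<tau> \<omega>")
      case True
      then show ?thesis
        using late[OF *(1), of "ennreal (posterior a (\<zeta> t \<omega>))"] *(2) by (simp add: mult_ac)
    next
      case False
      then show ?thesis
        using \<zeta>_early[OF *(2)] posterior_signal[OF *(2), of a] *(2)
        by (auto simp: indicator_def)
    qed
  qed
  finally show ?thesis .
qed

section \<open>From cylinder events to the completed filtration\<close>

abbreviation "\<F> \<equiv> completed_natural_filtration M \<zeta> t"

text \<open>
  A \<open>\<pi>\<close>-system containing all generators of \<open>\<F>\<close>. Closing it under almost sure equality absorbs the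
  null sets, and also the time \<open>0\<close>, at which the signal vanishes almost surely.
\<close>

definition cylinders :: "'a set set" where
  "cylinders = {E \<in> sets M. \<exists>J C A. finite J \<and> J \<subseteq> {0<..<t} \<and> C \<in> sets borel \<and> (\<forall>s. A s \<in> sets borel)
     \<and> (AE \<omega> in M. \<omega> \<in> E \<longleftrightarrow> \<zeta> t \<omega> \<in> C \<and> (\<forall>s\<in>J. \<zeta> s \<omega> \<in> A s))}"

lemma cylindersI:
  assumes "E \<in> sets M" "finite J" "J \<subseteq> {0<..<t}" "C \<in> sets borel" "\<And>s. A s \<in> sets borel"
    "AE \<omega> in M. \<omega> \<in> E \<longleftrightarrow> \<zeta> t \<omega> \<in> C \<and> (\<forall>s\<in>J. \<zeta> s \<omega> \<in> A s)"
  shows "E \<in> cylinders"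
  unfolding cylinders_def using assms by blast

lemma cylindersE:
  assumes "E \<in> cylinders"
  obtains J C A where "E \<in> sets M" "finite J" "J \<subseteq> {0<..<t}" "C \<in> sets borel" "\<And>s. A s \<in> sets borel"
    "AE \<omega> in M. \<omega> \<in> E \<longleftrightarrow> \<zeta> t \<omega> \<in> C \<and> (\<forall>s\<in>J. \<zeta> s \<omega> \<in> A s)"
  using assms unfolding cylinders_def by blast

lemma cylinders_subset: "cylinders \<subseteq> sets M"
  by (auto simp: cylinders_def)

lemma space_in_cylinders: "space M \<in> cylinders"
  by (rule cylindersI[where J="{}" and C=UNIV and A="\<lambda>_. UNIV"]) auto

lemma Int_stable_cylinders: "Int_stable cylinders"
proof (rule Int_stableI)
  fix E E' assume EE': "E \<in> cylinders" "E' \<in> cylinders"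
  from EE'(1) obtain J C A where
    E: "E \<in> sets M" "finite J" "J \<subseteq> {0<..<t}" "C \<in> sets borel" "\<And>s. A s \<in> sets borel"
    "AE \<omega> in M. \<omega> \<in> E \<longleftrightarrow> \<zeta> t \<omega> \<in> C \<and> (\<forall>s\<in>J. \<zeta> s \<omega> \<in> A s)"
    by (rule cylindersE) blast
  from EE'(2) obtain J' C' A' where
    E': "E' \<in> sets M" "finite J'" "J' \<subseteq> {0<..<t}" "C' \<in> sets borel" "\<And>s. A' s \<in> sets borel"
    "AE \<omega> in M. \<omega> \<in> E' \<longleftrightarrow> \<zeta> t \<omega> \<in> C' \<and> (\<forall>s\<in>J'. \<zeta> s \<omega> \<in> A' s)"
    by (rule cylindersE) blast
  show "E \<inter> E' \<in> cylinders"
  proof (rule cylindersI)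
    show "E \<inter> E' \<in> sets M" "finite (J \<union> J')" "J \<union> J' \<subseteq> {0<..<t}" "C \<inter> C' \<in> sets borel"
      using E(1-4) E'(1-4) by auto
    \<comment> \<open>A time observed by only one of the two events gets the vacuous condition
      \<open>UNIV\<close> from the other.\<close>
    show "(if s \<in> J then A s else UNIV) \<inter> (if s \<in> J' then A' s else UNIV) \<in> sets borel" for s
      using E(5) E'(5) by auto
    show "AE \<omega> in M. \<omega> \<in> E \<inter> E' \<longleftrightarrow> \<zeta> t \<omega> \<in> C \<inter> C' \<and>
        (\<forall>s\<in>J \<union> J'. \<zeta> s \<omega> \<in> (if s \<in> J then A s else UNIV) \<inter> (if s \<in> J' then A' s else UNIV))"
      using E(6) E'(6) by eventually_elim auto
  qed
qed

lemma AE_\<zeta>_0: "AE \<omega> in M. \<zeta> 0 \<omega> = 0"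
  using AE_W_0 AE_space
proof eventually_elim
  case (elim \<omega>)
  then show ?case using \<tau>_pos[of \<omega>] t_pos t_less by (simp add: information_process_def)
qed

lemma \<zeta>_vimage_in_cylinders:
  assumes s: "s \<in> {0..t}" and A: "A \<in> sets borel"
  shows "\<zeta> s -` A \<inter> space M \<in> cylinders"
proof -
  have meas: "\<zeta> s -` A \<inter> space M \<in> sets M"
    using s A by (intro measurable_sets[OF borel_measurable_\<zeta>]) auto
  consider "s = 0" | "0 < s" "s < t" | "s = t" using s by force
  then show ?thesis
  proof cases
    case 1
    \<comment> \<open>\<open>\<zeta> 0 = 0\<close> almost surely, so the event is almost surely
      everything or nothing, and \<open>C\<close> records which.\<close>
    show ?thesis
    proof (rule cylindersI[OF meas, where J="{}" and C="if 0 \<in> A then UNIV else {}" and A="\<lambda>_. UNIV"])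
      show "AE \<omega> in M. \<omega> \<in> \<zeta> s -` A \<inter> space M \<longleftrightarrow> \<zeta> t \<omega> \<in> (if 0 \<in> A then UNIV else {}) \<and> (\<forall>s\<in>{}. \<zeta> s \<omega> \<in> UNIV)"
        using AE_\<zeta>_0 AE_space by eventually_elim (simp add: 1)
    qed auto
  next
    case 2
    then show ?thesis
      by (intro cylindersI[OF meas, where J="{s}" and C=UNIV and A="\<lambda>_. A"]) (auto simp: A)
  next
    case 3
    then show ?thesis
      by (intro cylindersI[OF meas, where J="{}" and C=A and A="\<lambda>_. UNIV"]) (auto simp: A)
  qed
qed

lemma null_sets_cylinders: "N \<in> null_sets M \<Longrightarrow> N \<in> cylinders"
  by (rule cylindersI[where J="{}" and C="{}" and A="\<lambda>_. UNIV"]) (auto dest: AE_not_in)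

lemma space_\<F> [simp]: "space \<F> = space M"
  by (simp add: completed_natural_filtration_def space_measure_of_conv)

lemma sets_\<F>: "sets \<F> = sigma_sets (space M)
    ({\<zeta> s -` A \<inter> space M | s A. s \<in> {0..t} \<and> A \<in> sets borel} \<union> null_sets M)"
  unfolding completed_natural_filtration_def
  by (rule sets_measure_of) (use sets.sets_into_space in \<open>fastforce simp: null_sets_def\<close>)

text \<open>An identity on everything generated by the cylinders will therefore hold on the
  filtration.\<close>

lemma sets_\<F>_subset: "sets \<F> \<subseteq> sigma_sets (space M) cylinders"
  unfolding sets_\<F>
proof (rule sigma_sets_mono, rule subset_trans[OF _ subsetI[OF sigma_sets.Basic]])
  show "{\<zeta> s -` A \<inter> space M | s A. s \<in> {0..t} \<and> A \<in> sets borel} \<union> null_sets M \<subseteq> cylinders"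
    using \<zeta>_vimage_in_cylinders null_sets_cylinders by blast
qed

lemma subalgebra_\<F>: "subalgebra M \<F>"
  unfolding subalgebra_def using sets_\<F>_subset sets.sigma_sets_subset[OF cylinders_subset] by auto

lemma borel_measurable_\<F>_\<zeta>: "\<zeta> t \<in> borel_measurable \<F>"
proof (rule measurableI)
  fix A :: "real set" assume "A \<in> sets borel"
  then have "\<zeta> t -` A \<inter> space M \<in> sets \<F>"
    unfolding sets_\<F> using t_pos by (intro sigma_sets.Basic) fastforce
  then show "\<zeta> t -` A \<inter> space \<F> \<in> sets \<F>" by simp
qed simp

text \<open>Both sides are finite measures in \<open>E\<close> that agree on a \<pi>-system
  containing the whole space, hence on all that it generates.\<close>

lemma nn_integral_posterior_\<F>:
  assumes a: "a \<in> V" and E: "E \<in> sets \<F>"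
  shows "(\<integral>\<^sup>+\<omega>. indicator {\<omega> \<in> space M. Z \<omega> = a} \<omega> * indicator E \<omega> \<partial>M)
      = (\<integral>\<^sup>+\<omega>. ennreal (posterior a (\<zeta> t \<omega>)) * indicator E \<omega> \<partial>M)"
proof -
  note borel_measurable_\<zeta>[OF less_imp_le[OF t_pos], measurable]
  define G where "G = sigma (space M) cylinders"
  have pow: "cylinders \<subseteq> Pow (space M)"
    using cylinders_subset sets.space_closed[of M] by blast
  have sets_G: "sets G = sigma_sets (space M) cylinders" and space_G: "space G = space M"
    unfolding G_def using pow by auto
  have G_sub: "sets G \<subseteq> sets M"
    unfolding sets_G by (rule sets.sigma_sets_subset[OF cylinders_subset])
  let ?N1 = "density M (indicator {\<omega> \<in> space M. Z \<omega> = a})"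
  let ?N2 = "density M (\<lambda>\<omega>. ennreal (posterior a (\<zeta> t \<omega>)))"
  \<comment> \<open>Uniqueness concerns measures whose measurable sets are exactly the generated
    ones, so both densities on \<open>M\<close> are restricted to \<open>G\<close>.\<close>
  have sub: "subalgebra ?N1 G" "subalgebra ?N2 G"
    using G_sub space_G by (auto simp: subalgebra_def)
  have "restr_to_subalg ?N1 G = restr_to_subalg ?N2 G"
  proof (rule measure_eqI_generator_eq[OF Int_stable_cylinders pow])
    fix X assume X: "X \<in> cylinders"
    then have X': "X \<in> sets G" "X \<in> sets M" using cylinders_subset by (auto simp: sets_G)
    from X obtain J C A where "finite J" "J \<subseteq> {0<..<t}" "\<And>s. A s \<in> sets borel" "C \<in> sets borel"
      "X \<in> sets M" "AE \<omega> in M. \<omega> \<in> X \<longleftrightarrow> \<zeta> t \<omega> \<in> C \<and> (\<forall>s\<in>J. \<zeta> s \<omega> \<in> A s)"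
      by (rule cylindersE) blast
    from nn_integral_posterior_cylinder[OF a this]
    show "emeasure (restr_to_subalg ?N1 G) X = emeasure (restr_to_subalg ?N2 G) X"
      using X' by (simp add: emeasure_restr_to_subalg[OF sub(1)] emeasure_restr_to_subalg[OF sub(2)] emeasure_density)
  next
    show "emeasure (restr_to_subalg ?N1 G) (space M) \<noteq> \<infinity>"
    proof -
      have "space M \<in> sets G" using sets.top[of G] space_G by simp
      moreover have "emeasure ?N1 (space M) = emeasure M {\<omega> \<in> space M. Z \<omega> = a}"
        by (simp add: emeasure_density nn_integral_cong[of M "\<lambda>\<omega>. indicator _ \<omega> * indicator (space M) \<omega>" "indicator _"])
      ultimately show ?thesis by (simp add: emeasure_restr_to_subalg[OF sub(1)])
    qed
    show "sets (restr_to_subalg ?N1 G) = sigma_sets (space M) cylinders"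
      "sets (restr_to_subalg ?N2 G) = sigma_sets (space M) cylinders"
      using sets_restr_to_subalg[OF sub(1)] sets_restr_to_subalg[OF sub(2)] sets_G by simp_all
    show "range (\<lambda>_. space M) \<subseteq> cylinders" "(\<Union>i. space M) = space M"
      using space_in_cylinders by auto
  qed
  moreover have "E \<in> sets G" "E \<in> sets M"
    using E sets_\<F>_subset G_sub by (auto simp: sets_G)
  ultimately have "emeasure ?N1 E = emeasure ?N2 E"
    using emeasure_restr_to_subalg[OF sub(1), of E] emeasure_restr_to_subalg[OF sub(2), of E] by simp
  then show ?thesis using \<open>E \<in> sets M\<close> by (simp add: emeasure_density)
qed

text \<open>\<open>Z\<close> is a finite combination of the indicators of \<open>Z = a\<close>. The
  conditional expectation of each is its posterior, which is bounded, measurable for the filtration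
  as a function of \<open>\<zeta> t\<close>, and has the right integral over each of its
  events.\<close>

lemma AE_cond_exp_Z: "AE \<omega> in M. real_cond_exp M \<F> Z \<omega> = (\<Sum>a\<in>V. a * posterior a (\<zeta> t \<omega>))"
proof -
  note borel_measurable_\<zeta>[OF less_imp_le[OF t_pos], measurable]
  interpret finite_measure_subalgebra M \<F>
    by unfold_locales (rule subalgebra_\<F>)
  have int: "integrable M (indicator {\<omega> \<in> space M. Z \<omega> = a} :: 'a \<Rightarrow> real)" for a
    by (rule integrable_real_indicator) (simp_all add: emeasure_eq_measure)
  have int_p: "integrable M (\<lambda>\<omega>. posterior a (\<zeta> t \<omega>))" if "a \<in> V" for a
    using posterior_le_1[OF that] by (intro integrable_const_bound[where B=1]) auto
  have post: "AE \<omega> in M. real_cond_exp M \<F> (indicator {\<omega> \<in> space M. Z \<omega> = a}) \<omega> = posterior a (\<zeta> t \<omega>)"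
    if a: "a \<in> V" for a
  proof (rule real_cond_exp_charact)
    fix E assume E: "E \<in> sets \<F>"
    then have [measurable]: "E \<in> sets M" using subalgebra_\<F> by (auto simp: subalgebra_def)
    have "(\<integral>\<omega>\<in>E. indicator {\<omega> \<in> space M. Z \<omega> = a} \<omega> \<partial>M)
        = enn2real (\<integral>\<^sup>+\<omega>. ennreal (indicator E \<omega> * indicator {\<omega> \<in> space M. Z \<omega> = a} \<omega>) \<partial>M)"
      unfolding set_lebesgue_integral_def real_scaleR_def by (rule integral_eq_nn_integral) auto
    also have "(\<integral>\<^sup>+\<omega>. ennreal (indicator E \<omega> * indicator {\<omega> \<in> space M. Z \<omega> = a} \<omega>) \<partial>M)
        = (\<integral>\<^sup>+\<omega>. indicator {\<omega> \<in> space M. Z \<omega> = a} \<omega> * indicator E \<omega> \<partial>M)"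
      by (intro nn_integral_cong) (auto simp: indicator_def)
    also have "\<dots> = (\<integral>\<^sup>+\<omega>. ennreal (posterior a (\<zeta> t \<omega>)) * indicator E \<omega> \<partial>M)"
      by (rule nn_integral_posterior_\<F>[OF a E])
    also have "\<dots> = (\<integral>\<^sup>+\<omega>. ennreal (indicator E \<omega> * posterior a (\<zeta> t \<omega>)) \<partial>M)"
      by (intro nn_integral_cong) (auto simp: indicator_def)
    also have "enn2real \<dots> = (\<integral>\<omega>\<in>E. posterior a (\<zeta> t \<omega>) \<partial>M)"
      unfolding set_lebesgue_integral_def real_scaleR_def by (rule integral_eq_nn_integral[symmetric]) auto
    finally show "(\<integral>\<omega>\<in>E. indicator {\<omega> \<in> space M. Z \<omega> = a} \<omega> \<partial>M) = (\<integral>\<omega>\<in>E. posterior a (\<zeta> t \<omega>) \<partial>M)" .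
  next
    show "(\<lambda>\<omega>. posterior a (\<zeta> t \<omega>)) \<in> borel_measurable \<F>"
      by (rule measurable_compose[OF borel_measurable_\<F>_\<zeta> borel_measurable_posterior])
  qed (use int int_p[OF a] in auto)
  have sum_Z: "Z \<omega> = (\<Sum>a\<in>V. a * indicator {\<omega> \<in> space M. Z \<omega> = a} \<omega>)" if "\<omega> \<in> space M" for \<omega>
    using that Z_in_V[OF that] finite_V by (simp add: indicator_def)
  have "AE \<omega> in M. real_cond_exp M \<F> Z \<omega>
      = real_cond_exp M \<F> (\<lambda>\<omega>. \<Sum>a\<in>V. a * indicator {\<omega> \<in> space M. Z \<omega> = a} \<omega>) \<omega>"
    by (rule real_cond_exp_cong) (auto intro!: AE_I2 sum_Z)
  moreover have "AE \<omega> in M. real_cond_exp M \<F> (\<lambda>\<omega>. \<Sum>a\<in>V. a * indicator {\<omega> \<in> space M. Z \<omega> = a} \<omega>) \<omega>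
      = (\<Sum>a\<in>V. real_cond_exp M \<F> (\<lambda>\<omega>. a * indicator {\<omega> \<in> space M. Z \<omega> = a} \<omega>) \<omega>)"
    using int by (intro real_cond_exp_sum) auto
  moreover have "AE \<omega> in M. \<forall>a\<in>V. real_cond_exp M \<F> (\<lambda>\<omega>. a * indicator {\<omega> \<in> space M. Z \<omega> = a} \<omega>) \<omega>
      = a * real_cond_exp M \<F> (indicator {\<omega> \<in> space M. Z \<omega> = a}) \<omega>"
    by (intro AE_finite_allI finite_V real_cond_exp_cmult int)
  moreover have "AE \<omega> in M. \<forall>a\<in>V. real_cond_exp M \<F> (indicator {\<omega> \<in> space M. Z \<omega> = a}) \<omega> = posterior a (\<zeta> t \<omega>)"
    by (intro AE_finite_allI finite_V post)
  ultimately show ?thesis by eventually_elim simp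
qed

text \<open>The payoff is almost surely a function \<open>q\<close> of \<open>\<zeta> t\<close>.
  Where \<open>\<tau> \<le> t\<close> it is the payoff with \<open>Z\<close> known, which gives the
  sum; elsewhere \<open>q\<close> is integrated against the total weight, and the product no longer
  contains the normalisation.\<close>

lemma expectation_call_payoff:
  "(LINT \<omega>|M. max (c * real_cond_exp M \<F> Z \<omega> - K) 0)
     = (\<Sum>a\<in>V. max (c * a - K) 0 * prob {\<omega> \<in> space M. \<tau> \<omega> \<le> t \<and> Z \<omega> = a})
     + (LBINT x. max (\<Sum>a\<in>V. (c * a - K) * late_weight a x) 0)"
proof -
  note borel_measurable_\<zeta>[OF less_imp_le[OF t_pos], measurable]
  define q where "q x = max (c * (\<Sum>a\<in>V. a * posterior a x) - K) 0" for x
  have [measurable]: "q \<in> borel_measurable borel" unfolding q_def[abs_def] by measurable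
  have q0: "0 \<le> q x" for x by (simp add: q_def)
  have q_signal: "q (\<sigma> * Z \<omega>) = max (c * Z \<omega> - K) 0" if "\<omega> \<in> space M" for \<omega>
    using Z_in_V[OF that] finite_V by (simp add: q_def posterior_signal[OF that] indicator_def)
  let ?E = "\<lambda>a. {\<omega> \<in> space M. \<tau> \<omega> \<le> t \<and> Z \<omega> = a}"
  let ?R = "\<lambda>x. max (\<Sum>a\<in>V. (c * a - K) * late_weight a x) 0"
  \<comment> \<open>The positive part commutes with multiplication by the nonnegative total weight,
    which cancels the denominator of the posterior.\<close>
  have q_late: "q x * (\<Sum>a\<in>V. late_weight a x) = ?R x" if x: "x \<notin> (\<lambda>a. \<sigma> * a) ` V" for x
  proof -
    let ?S = "\<Sum>a\<in>V. late_weight a x"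
    have "q x * ?S = max ((c * (\<Sum>a\<in>V. a * posterior a x) - K) * ?S) 0"
      using sum_nonneg[of V "\<lambda>a. late_weight a x"] by (simp add: q_def max_mult_distrib_right)
    also have "(c * (\<Sum>a\<in>V. a * posterior a x) - K) * ?S = c * (\<Sum>a\<in>V. a * (posterior a x * ?S)) - K * ?S"
      by (simp add: left_diff_distrib sum_distrib_right mult.assoc)
    also have "\<dots> = c * (\<Sum>a\<in>V. a * late_weight a x) - K * ?S"
      using x by (simp add: posterior_times_sum)
    also have "\<dots> = (\<Sum>a\<in>V. (c * a - K) * late_weight a x)"
      by (simp add: left_diff_distrib sum_subtractf sum_distrib_left mult.assoc)
    finally show ?thesis .
  qed
  have "(LINT \<omega>|M. max (c * real_cond_exp M \<F> Z \<omega> - K) 0) = (LINT \<omega>|M. q (\<zeta> t \<omega>))"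
  proof (rule integral_cong_AE)
    show "(\<lambda>\<omega>. max (c * real_cond_exp M \<F> Z \<omega> - K) 0) \<in> borel_measurable M"
      using measurable_from_subalg[OF subalgebra_\<F> borel_measurable_cond_exp[of M \<F> Z]] by measurable
    show "AE \<omega> in M. max (c * real_cond_exp M \<F> Z \<omega> - K) 0 = q (\<zeta> t \<omega>)"
      using AE_cond_exp_Z by eventually_elim (simp add: q_def)
  qed simp
  also have "\<dots> = enn2real (\<integral>\<^sup>+\<omega>. ennreal (q (\<zeta> t \<omega>)) \<partial>M)"
    by (rule integral_eq_nn_integral) (auto simp: q0)
  also have "(\<integral>\<^sup>+\<omega>. ennreal (q (\<zeta> t \<omega>)) \<partial>M)
     = (\<integral>\<^sup>+\<omega>. (\<Sum>a\<in>V. ennreal (max (c * a - K) 0) * indicator (?E a) \<omega>)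
          + ennreal (q (\<zeta> t \<omega>)) * indicator {\<omega> \<in> space M. t < \<tau> \<omega>} \<omega> \<partial>M)"
  proof (rule nn_integral_cong)
    fix \<omega> assume \<omega>: "\<omega> \<in> space M"
    show "ennreal (q (\<zeta> t \<omega>)) = (\<Sum>a\<in>V. ennreal (max (c * a - K) 0) * indicator (?E a) \<omega>)
          + ennreal (q (\<zeta> t \<omega>)) * indicator {\<omega> \<in> space M. t < \<tau> \<omega>} \<omega>"
    proof (cases "t < \<tau> \<omega>")
      case True
      then show ?thesis using \<omega> by simp
    next
      case False
      then have "(\<Sum>a\<in>V. ennreal (max (c * a - K) 0) * indicator (?E a) \<omega>)
          = (\<Sum>a\<in>V. if a = Z \<omega> then ennreal (max (c * a - K) 0) else 0)"
        using \<omega> by (intro sum.cong) (auto simp: indicator_def)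
      then show ?thesis
        using False \<omega> Z_in_V[OF \<omega>] finite_V \<zeta>_early[OF \<omega>] q_signal[OF \<omega>] by simp
    qed
  qed
  also have "\<dots> = (\<Sum>a\<in>V. ennreal (max (c * a - K) 0) * emeasure M (?E a))
          + (\<integral>\<^sup>+\<omega>. ennreal (q (\<zeta> t \<omega>)) * indicator {\<omega> \<in> space M. t < \<tau> \<omega>} \<omega> \<partial>M)"
    by (subst nn_integral_add) (simp_all add: nn_integral_sum nn_integral_cmult)
  also have "(\<Sum>a\<in>V. ennreal (max (c * a - K) 0) * emeasure M (?E a))
      = ennreal (\<Sum>a\<in>V. max (c * a - K) 0 * prob (?E a))"
    by (subst sum_ennreal[symmetric]) (auto simp: emeasure_eq_measure ennreal_mult)
  also have "(\<integral>\<^sup>+\<omega>. ennreal (q (\<zeta> t \<omega>)) * indicator {\<omega> \<in> space M. t < \<tau> \<omega>} \<omega> \<partial>M)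
      = (\<integral>\<^sup>+x. ennreal (q x) * ennreal (\<Sum>a\<in>V. late_weight a x) \<partial>lborel)"
    using nn_integral_late_sum[of "{}" "\<lambda>(b, x). ennreal (q x)"] by (simp add: emeasure_space_1)
  also have "\<dots> = (\<integral>\<^sup>+x. ennreal (?R x) \<partial>lborel)"
    using AE_lborel_not_signal
    by (intro nn_integral_cong_AE, eventually_elim) (simp add: q0 q_late ennreal_mult[symmetric] sum_nonneg)
  also have "enn2real (ennreal (\<Sum>a\<in>V. max (c * a - K) 0 * prob (?E a)) + (\<integral>\<^sup>+x. ennreal (?R x) \<partial>lborel))
      = (\<Sum>a\<in>V. max (c * a - K) 0 * prob (?E a)) + (LBINT x. ?R x)"
  proof -
    \<comment> \<open>\<open>enn2real\<close> is additive only on finite values. Each weight has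
      total mass at most one, so the positive part of a finite combination of them is
      integrable.\<close>
    have int: "integrable lborel (late_weight a)" for a
    proof (rule integrableI_nonneg)
      have "(\<integral>\<^sup>+x. ennreal (late_weight a x) \<partial>lborel) = (\<integral>\<^sup>+x. late_density a x \<partial>lborel)"
        using AE_late_density[of a] by (intro nn_integral_cong_AE) auto
      then show "(\<integral>\<^sup>+x. ennreal (late_weight a x) \<partial>lborel) < \<infinity>"
        by (simp add: nn_integral_late_density emeasure_eq_measure)
    qed auto
    have "integrable lborel ?R"
      using int by (intro integrable_max Bochner_Integration.integrable_sum) auto
    then have "(\<integral>\<^sup>+x. ennreal (?R x) \<partial>lborel) = ennreal (LBINT x. ?R x)"
      by (intro nn_integral_eq_integral) auto
    moreover have "0 \<le> (LBINT x. ?R x)" by (rule integral_nonneg_AE) auto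
    moreover have "0 \<le> (\<Sum>a\<in>V. max (c * a - K) 0 * prob (?E a))" by (intro sum_nonneg) auto
    ultimately show ?thesis by (simp add: ennreal_plus[symmetric] del: ennreal_plus)
  qed
  finally show ?thesis .
qed

subsection \<open>Pricing\<close>

context
  fixes f :: "real \<Rightarrow> real \<Rightarrow> real" and a :: real
  assumes f_nonneg: "\<And>r. 0 \<le> r \<Longrightarrow> 0 \<le> f r a"
    and a_pos: "0 < prob {\<omega> \<in> space M. Z \<omega> = a}"
    and f_density: "distributed (uniform_measure M {\<omega> \<in> space M. Z \<omega> = a}) lborel \<tau>
             (\<lambda>r. ennreal (indicator {0..} r * f r a))"
begin

text \<open>The density hypothesis yields measurability of the extended-valued function; by
  nonnegativity on the half-line, \<open>enn2real\<close> recovers the real one. Nothing is known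
  about \<open>f\<close> at negative arguments, hence the indicators here and below.\<close>

lemma borel_measurable_f: "(\<lambda>r. indicator {0..} r * f r a) \<in> borel_measurable borel"
proof -
  have "(\<lambda>r. enn2real (ennreal (indicator {0..} r * f r a))) \<in> borel_measurable borel"
    using distributed_borel_measurable[OF f_density] by measurable
  moreover have "enn2real (ennreal (indicator {0..} r * f r a)) = indicator {0..} r * f r a" for r
    using f_nonneg[of r] by (simp add: indicator_def)
  ultimately show ?thesis by simp
qed

lemma borel_measurable_f_on:
  assumes "A \<subseteq> {0..}" and [measurable]: "A \<in> sets borel"
  shows "(\<lambda>r. indicator A r * f r a) \<in> borel_measurable borel"
proof -
  note borel_measurable_f [measurable]
  have "(\<lambda>r. indicator A r * (indicator {0..} r * f r a)) \<in> borel_measurable borel" by measurable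
  moreover have "indicator A r * (indicator {0..} r * f r a) = indicator A r * f r a" for r
    using assms(1) by (auto simp: indicator_def)
  ultimately show ?thesis by simp
qed

text \<open>Conditioning on \<open>Z = a\<close> divides by the probability of this event;
  multiplying back by that positive finite number recovers the integral over the event.\<close>

lemma nn_integral_given_Z:
  assumes g [measurable]: "g \<in> borel_measurable borel"
  shows "(\<integral>\<^sup>+\<omega>. g (\<tau> \<omega>) * indicator {\<omega> \<in> space M. Z \<omega> = a} \<omega> \<partial>M)
    = ennreal (prob {\<omega> \<in> space M. Z \<omega> = a}) * (\<integral>\<^sup>+r. ennreal (indicator {0..} r * f r a) * g r \<partial>lborel)"
proof -
  have "(\<integral>\<^sup>+r. ennreal (indicator {0..} r * f r a) * g r \<partial>lborel)
      = (\<integral>\<^sup>+\<omega>. g (\<tau> \<omega>) \<partial>uniform_measure M {\<omega> \<in> space M. Z \<omega> = a})"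
    by (rule distributed_nn_integral[OF f_density]) simp
  also have "\<dots> = (\<integral>\<^sup>+\<omega>. g (\<tau> \<omega>) * indicator {\<omega> \<in> space M. Z \<omega> = a} \<omega> \<partial>M)
      / ennreal (prob {\<omega> \<in> space M. Z \<omega> = a})"
    by (subst nn_integral_uniform_measure) (simp_all add: emeasure_eq_measure)
  finally show ?thesis
    using a_pos by (simp add: ennreal_times_divide mult.commute[of "ennreal _"] ennreal_mult_divide_eq)
qed

lemma prob_early:
  "prob {\<omega> \<in> space M. \<tau> \<omega> \<le> t \<and> Z \<omega> = a} = (LBINT r:{0..t}. f r a) * prob {\<omega> \<in> space M. Z \<omega> = a}"
proof -
  have [measurable]: "(\<lambda>r. indicator {0..t} r * f r a) \<in> borel_measurable borel"
    by (rule borel_measurable_f_on) auto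
  have nonneg: "0 \<le> indicator {0..t} r * f r a" for r
    using f_nonneg[of r] by (auto simp: indicator_def)
  have "emeasure M {\<omega> \<in> space M. \<tau> \<omega> \<le> t \<and> Z \<omega> = a}
      = (\<integral>\<^sup>+\<omega>. indicator {..t} (\<tau> \<omega>) * indicator {\<omega> \<in> space M. Z \<omega> = a} \<omega> \<partial>M)"
  proof -
    have "(\<integral>\<^sup>+\<omega>. indicator {..t} (\<tau> \<omega>) * indicator {\<omega> \<in> space M. Z \<omega> = a} \<omega> \<partial>M)
        = (\<integral>\<^sup>+\<omega>. indicator {\<omega> \<in> space M. \<tau> \<omega> \<le> t \<and> Z \<omega> = a} \<omega> \<partial>M)"
      by (intro nn_integral_cong) (auto simp: indicator_def)
    then show ?thesis by simp
  qed
  also have "\<dots> = ennreal (prob {\<omega> \<in> space M. Z \<omega> = a}) *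
      (\<integral>\<^sup>+r. ennreal (indicator {0..} r * f r a) * indicator {..t} r \<partial>lborel)"
    by (rule nn_integral_given_Z) simp
  also have "(\<integral>\<^sup>+r. ennreal (indicator {0..} r * f r a) * indicator {..t} r \<partial>lborel)
      = (\<integral>\<^sup>+r. ennreal (indicator {0..t} r * f r a) \<partial>lborel)"
    by (intro nn_integral_cong) (auto simp: indicator_def)
  finally have "enn2real (emeasure M {\<omega> \<in> space M. \<tau> \<omega> \<le> t \<and> Z \<omega> = a}) =
      prob {\<omega> \<in> space M. Z \<omega> = a} * enn2real (\<integral>\<^sup>+r. ennreal (indicator {0..t} r * f r a) \<partial>lborel)"
    by (simp add: enn2real_mult)
  also have "enn2real (\<integral>\<^sup>+r. ennreal (indicator {0..t} r * f r a) \<partial>lborel) = (LBINT r:{0..t}. f r a)"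
    unfolding set_lebesgue_integral_def real_scaleR_def
    by (rule integral_eq_nn_integral[symmetric]) (simp_all add: nonneg)
  finally show ?thesis by (simp add: measure_def mult.commute)
qed

text \<open>Values of \<open>\<tau>\<close> up to \<open>T\<close> contribute the integral of bridge
  densities; all larger ones share the density for pinning at \<open>T\<close>, so their mass
  \<open>density_tail f T a\<close> factors out.\<close>

lemma AE_late_weight:
  "AE x in lborel. late_weight a x =
     ((LBINT r:{t<..T}. bridge_density \<sigma> t r a x * f r a) + density_tail f T a * bridge_density \<sigma> t T a x)
       * prob {\<omega> \<in> space M. Z \<omega> = a}"
  using AE_late_density[of a]
proof eventually_elim
  fix x assume fin: "late_density a x = ennreal (late_weight a x)"
  note borel_measurable_bridge_density [measurable (raw)]
  have [measurable]: "(\<lambda>r. indicator {t<..T} r * f r a) \<in> borel_measurable borel"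
    "(\<lambda>r. indicator {T..} r * f r a) \<in> borel_measurable borel"
    using t_pos t_less by (auto intro!: borel_measurable_f_on)
  let ?P = "prob {\<omega> \<in> space M. Z \<omega> = a}" and ?b = "\<lambda>r. bridge_density \<sigma> t r a x"
  let ?A = "\<integral>\<^sup>+r. ennreal (indicator {t<..T} r * f r a * ?b r) \<partial>lborel"
  let ?B = "\<integral>\<^sup>+r. ennreal (indicator {T..} r * f r a) \<partial>lborel"
  have nonneg: "0 \<le> indicator {t<..T} r * f r a" "0 \<le> indicator {T..} r * f r a" for r
    using f_nonneg[of r] t_pos t_less by (auto simp: indicator_def)
  have "late_density a x = (\<integral>\<^sup>+\<omega>. (\<lambda>r. ennreal (?b (min r T)) * indicator {t<..} r) (\<tau> \<omega>)
      * indicator {\<omega> \<in> space M. Z \<omega> = a} \<omega> \<partial>M)"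
    unfolding late_density_def by (intro nn_integral_cong) (auto simp: indicator_def)
  also have "\<dots> = ennreal ?P * (\<integral>\<^sup>+r. ennreal (indicator {0..} r * f r a) *
      (ennreal (?b (min r T)) * indicator {t<..} r) \<partial>lborel)"
    by (rule nn_integral_given_Z) measurable
  also have "(\<integral>\<^sup>+r. ennreal (indicator {0..} r * f r a) * (ennreal (?b (min r T)) * indicator {t<..} r) \<partial>lborel)
      = (\<integral>\<^sup>+r. ennreal (indicator {t<..T} r * f r a * ?b r)
          + ennreal (indicator {T..} r * f r a) * ennreal (?b T) \<partial>lborel)"
  proof (rule nn_integral_cong_AE)
    \<comment> \<open>The two ranges \<open>{t<..T}\<close> and \<open>{T..}\<close> overlap at
      \<open>r = T\<close>, a Lebesgue-null point.\<close>
    show "AE r in lborel. ennreal (indicator {0..} r * f r a) * (ennreal (?b (min r T)) * indicator {t<..} r)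
        = ennreal (indicator {t<..T} r * f r a * ?b r) + ennreal (indicator {T..} r * f r a) * ennreal (?b T)"
      using AE_lborel_singleton[of T]
    proof eventually_elim
      case (elim r)
      then show ?case
        using f_nonneg[of r] t_pos t_less by (cases "r < T") (auto simp: indicator_def ennreal_mult)
    qed
  qed
  also have "\<dots> = ?A + ?B * ennreal (?b T)"
    by (subst nn_integral_add) (simp_all add: nn_integral_multc)
  finally have eq: "late_density a x = ennreal ?P * (?A + ?B * ennreal (?b T))" .
  \<comment> \<open>The finite density at \<open>x\<close> and the positive probability of
    \<open>Z = a\<close> force both summands to be finite, so that \<open>enn2real\<close>
    distributes over the sum.\<close>
  then have "?A + ?B * ennreal (?b T) \<noteq> \<top>"
    using fin a_pos by (auto simp: ennreal_mult_top)
  then have lt: "?A < \<top>" "?B * ennreal (?b T) < \<top>"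
    by (auto simp: less_top[symmetric])
  have "late_weight a x = ?P * (enn2real ?A + enn2real ?B * ?b T)"
    using lt by (simp add: late_weight_def eq enn2real_mult enn2real_plus)
  also have "enn2real ?A = (LBINT r:{t<..T}. ?b r * f r a)"
  proof -
    have "(LBINT r:{t<..T}. ?b r * f r a) = (LBINT r. indicator {t<..T} r * f r a * ?b r)"
      unfolding set_lebesgue_integral_def by (simp add: mult_ac)
    also have "\<dots> = enn2real ?A"
      by (rule integral_eq_nn_integral) (simp_all add: nonneg)
    finally show ?thesis by simp
  qed
  also have "enn2real ?B = density_tail f T a"
    unfolding density_tail_def set_lebesgue_integral_def
    by (subst integral_eq_nn_integral) (use nonneg in simp_all)
  finally show "late_weight a x = ((LBINT r:{t<..T}. ?b r * f r a) + density_tail f T a * ?b T) * ?P"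
    by (simp add: mult.commute)
qed

text \<open>The weights are identified only almost everywhere, and exchanging integrands by
  \<open>integral_cong_AE\<close> asks for measurability of the explicit ones.\<close>

lemma borel_measurable_bridge_mixture:
  "(\<lambda>x. LBINT r:{t<..T}. bridge_density \<sigma> t r a x * f r a) \<in> borel_measurable borel"
proof -
  note borel_measurable_bridge_density [measurable (raw)]
  have [measurable]: "(\<lambda>r. indicator {t<..T} r * f r a) \<in> borel_measurable borel"
    using t_pos by (auto intro!: borel_measurable_f_on)
  have "(\<lambda>x. LBINT r. bridge_density \<sigma> t r a x * (indicator {t<..T} r * f r a)) \<in> borel_measurable borel"
    by measurable
  then show ?thesis unfolding set_lebesgue_integral_def by (simp add: mult_ac)
qed

end

end

theorem proposition3p3:
  fixes M :: "'a measure"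
    and W :: "real \<Rightarrow> 'a \<Rightarrow> real"
    and \<tau> Z :: "'a \<Rightarrow> real"
    and f :: "real \<Rightarrow> real \<Rightarrow> real"
    and z p :: "nat \<Rightarrow> real"
    and l :: nat
    and \<rho> :: "real \<Rightarrow> real"
    and T \<sigma> K t :: real
  assumes "prob_space M" and "complete_measure M"
    and "T > 0" and "\<sigma> > 0"
    and "standard_brownian_motion M W"
    and "\<tau> \<in> borel_measurable M" and "\<And>\<omega>. \<omega> \<in> space M \<Longrightarrow> \<tau> \<omega> > 0"
    and "Z \<in> borel_measurable M"
    and "prob_space.indep_set M
           (sets (vimage_algebra (space M) (\<lambda>\<omega>. \<lambda>s\<in>{0..}. W s \<omega>) (PiM {0..} (\<lambda>_. borel))))
           (sets (vimage_algebra (space M) (\<lambda>\<omega>. (\<tau> \<omega>, Z \<omega>)) (borel \<Otimes>\<^sub>M borel)))"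
    and "inj_on z {1..l}"
    and "\<And>\<omega>. \<omega> \<in> space M \<Longrightarrow> Z \<omega> \<in> z ` {1..l}"
    and "\<And>i. i \<in> {1..l} \<Longrightarrow> measure M {\<omega> \<in> space M. Z \<omega> = z i} = p i"
    and "\<And>i. i \<in> {1..l} \<Longrightarrow> p i > 0"
    and "(\<Sum>i=1..l. p i) = 1"
    and "measure M {\<omega> \<in> space M. \<tau> \<omega> \<le> T} < 1"
    and "\<And>i. i \<in> {1..l} \<Longrightarrow> continuous_on {0..} (\<lambda>r. f r (z i))"
    and "\<And>i r. i \<in> {1..l} \<Longrightarrow> r \<ge> 0 \<Longrightarrow> f r (z i) \<ge> 0"
    and "\<And>i. i \<in> {1..l} \<Longrightarrow>
           distributed (uniform_measure M {\<omega> \<in> space M. Z \<omega> = z i}) lborel \<tau>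
             (\<lambda>r. ennreal (indicator {0..} r * f r (z i)))"
    and "0 < t" and "t < T"
  shows "call_price M \<rho> T \<sigma> W \<tau> Z K t =
           discount \<rho> 0 t *
             (\<Sum>i=1..l. max (discount \<rho> t T * z i - K) 0 * (LBINT r:{0..t}. f r (z i)) * p i)
         + discount \<rho> 0 t *
             (LBINT x. max
                (\<Sum>i=1..l. (discount \<rho> t T * z i - K) *
                   ((LBINT r:{t<..T}. bridge_density \<sigma> t r (z i) x * f r (z i))
                     + density_tail f T (z i) * bridge_density \<sigma> t T (z i) x) * p i)
                0)"
proof -
  let ?V = "z ` {1..l}" and ?P = "discount \<rho> t T"
  interpret prob_space M by fact
  interpret finite_bridge_market M W \<tau> Z T \<sigma> t ?V
    by unfold_locales (fact assms | simp | (rule complete_measure.complete[OF assms(2)]; assumption))+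
  define g where "g i x = (LBINT r:{t<..T}. bridge_density \<sigma> t r (z i) x * f r (z i))
      + density_tail f T (z i) * bridge_density \<sigma> t T (z i) x" for i x
  have pos: "0 < prob {\<omega> \<in> space M. Z \<omega> = z i}" if "i \<in> {1..l}" for i
    using assms(12,13)[OF that] by simp
  have early: "prob {\<omega> \<in> space M. \<tau> \<omega> \<le> t \<and> Z \<omega> = z i} = (LBINT r:{0..t}. f r (z i)) * p i"
    if "i \<in> {1..l}" for i
    using prob_early[where f=f and a="z i", OF assms(17)[OF that] pos[OF that] assms(18)[OF that]]
    unfolding assms(12)[OF that] .
  have late: "AE x in lborel. late_weight (z i) x = g i x * p i" if "i \<in> {1..l}" for i
    using AE_late_weight[where f=f and a="z i", OF assms(17)[OF that] pos[OF that] assms(18)[OF that]]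
    unfolding assms(12)[OF that] g_def .
  have meas: "g i \<in> borel_measurable borel" if "i \<in> {1..l}" for i
  proof -
    have mix: "(\<lambda>x. LBINT r:{t<..T}. bridge_density \<sigma> t r (z i) x * f r (z i)) \<in> borel_measurable borel"
      by (rule borel_measurable_bridge_mixture[where f=f and a="z i", OF assms(17)[OF that] pos[OF that] assms(18)[OF that]])
    have terminal: "(\<lambda>x. bridge_density \<sigma> t T (z i) x) \<in> borel_measurable borel"
      by (rule borel_measurable_bridge_density) simp_all
    show ?thesis
      unfolding g_def by (rule borel_measurable_add[OF mix borel_measurable_times[OF borel_measurable_const terminal]])
  qed
  have "(LINT \<omega>|M. max (bond_price M \<rho> T \<sigma> W \<tau> Z t \<omega> - K) 0)
     = (\<Sum>a\<in>?V. max (?P * a - K) 0 * prob {\<omega> \<in> space M. \<tau> \<omega> \<le> t \<and> Z \<omega> = a})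
     + (LBINT x. max (\<Sum>a\<in>?V. (?P * a - K) * late_weight a x) 0)"
    unfolding bond_price_def by (rule expectation_call_payoff)
  \<comment> \<open>Injectivity of \<open>z\<close> on the indices turns a sum over values of
    \<open>Z\<close> into a sum over indices.\<close>
  also have "(\<Sum>a\<in>?V. max (?P * a - K) 0 * prob {\<omega> \<in> space M. \<tau> \<omega> \<le> t \<and> Z \<omega> = a})
      = (\<Sum>i=1..l. max (?P * z i - K) 0 * (LBINT r:{0..t}. f r (z i)) * p i)"
    by (subst sum.reindex[OF assms(10)]) (auto intro!: sum.cong simp: early)
  also have "(LBINT x. max (\<Sum>a\<in>?V. (?P * a - K) * late_weight a x) 0)
      = (LBINT x. max (\<Sum>i=1..l. (?P * z i - K) * g i x * p i) 0)"
  proof (rule integral_cong_AE)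
    \<comment> \<open>There is one exceptional null set per index, and a finite union of null sets
      is null.\<close>
    have "AE x in lborel. \<forall>i\<in>{1..l}. late_weight (z i) x = g i x * p i"
      by (intro AE_finite_allI late) simp_all
    then show "AE x in lborel. max (\<Sum>a\<in>?V. (?P * a - K) * late_weight a x) 0
        = max (\<Sum>i=1..l. (?P * z i - K) * g i x * p i) 0"
      by eventually_elim (subst sum.reindex[OF assms(10)], simp add: mult.assoc)
    show "(\<lambda>x. max (\<Sum>i=1..l. (?P * z i - K) * g i x * p i) 0) \<in> borel_measurable lborel"
      using meas by (intro borel_measurable_max borel_measurable_sum borel_measurable_times) auto
  qed simp
  finally show ?thesis
    unfolding call_price_def g_def by (simp only: distrib_left)
qed

end
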